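(* Let $b^*\ge 0$ and suppose that the optimal stopping set of the problem $v(x)=\sup_{\tau\in\mathcal{T}}E_x(\rho^\tau g(X_\tau))$, $x\in\mathbb{R}$, is the interval $[b^*,\infty)$, with optimal stopping time $\tau_{b^*}=\inf\{n\in\mathbb{N}_0:X_n\ge b^*\}$. Assume that $$\lim_{\epsilon\searrow0}\Phi_i^{b^*}(b^*-\epsilon)=\lim_{\epsilon\searrow0}\Phi_i^{b^*+\epsilon}(b^* )\quad\text{for all }i=1,\dots,m,$$ and that $$E\big(g(R^i+\epsilon+b^* )\big)\to E\big(g(R^i+b^* )\big)\quad\text{as }\epsilon\to0,\qquad i=1,\dots,m,$$ where $R^i$ is a $PH(Q,e_i)$-distributed random variable. Then $$\lim_{b\nearrow b^*}v(b)=g(b^* ).$$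
   Context: $\mathbb{N}=\{1,2,\dots\}$, $\mathbb{N}_0=\mathbb{N}\cup\{0\}$, $e_i$ is the $i$-th unit (row) vector. $0<\rho<1$ and $g:\mathbb{R}\to[0,\infty)$ is a continuous gain function. Phasetype distributions: let $m\in\mathbb{N}$, $E=\{1,\dots,m\}$, $\Delta=m+1$, and consider continuous-time Markov chains on $E\cup\{\Delta\}$ in which $1,\dots,m$ are transient and $\Delta$ is absorbing, with generator $\hat Q=\begin{pmatrix}Q&-Q\mathbf 1\\0&0\end{pmatrix}$, where $Q$ is an $m\times m$ matrix and $\mathbf 1$ is the all-ones column vector. For a probability row vector $\alpha$, $PH(Q,\alpha)$ denotes the distribution of the absorption time $\inf\{t\ge0:J_t=\Delta\}$ of such a chain started with initial distribution $(\alpha,0)$. Process: let $0<\lambda<1$ and $X_n=\lambda X_{n-1}+Z_n$, $n\in\mathbb{N}$, where the innovations $Z_n=S_n-T_n$ are i.i.d., $S_n,T_n\ge 0$ are independent, $S_n$ is $PH(Q,\alpha)$-distributed and $T_n$ has an arbitrary distribution on $[0,\infty)$, subject to the paper's standing conditions $E(\log(1+|Z_1|))<\infty$ and that $\lambda^nQ$ and $Q$ have no common eigenvalue for any $n\in\mathbb{N}$. $P_x,E_x$ refer to $X_0=x$. $\mathcal{T}$ is the set of (possibly infinite) stopping times with respect to the filtration $(\mathcal{F}_n)_{n\in\mathbb{N}_0}$ generated by $(Z_n)_{n\in\mathbb{N}}$; payoffs are set equal to $0$ on $\{\tau=\infty\}$. For each $n$ let $S_n$ be realized as the absorption time of a Markov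 chain $(J^{(n)}_t)_{t\ge0}$ with generator $\hat Q$ and initial distribution $(\alpha,0)$; the chains $J^{(n)}$ and the variables $T_n$, $n\in\mathbb{N}$, are all independent, the $J^{(n)}$ being identically distributed and the $T_n$ being identically distributed. For $t\ge0$ put $n_t=\max\{n\in\mathbb{N}_0:\sum_{k=1}^nS_k\le t\}$, $J_t=J^{(n_t+1)}_{t-\sum_{k=1}^{n_t}S_k}$, $Y_t=\lambda X_{n_t}-T_{n_t+1}+t-\sum_{k=1}^{n_t}S_k$. For a threshold $b\ge0$ let $\tau_b=\inf\{n\in\mathbb{N}_0:X_n\ge b\}$, $\hat\tau_b=\inf\{t\ge0:Y_t\ge b\}$, $G_i^b=\{\hat\tau_b<\infty,\ J_{\hat\tau_b}=i\}$, and, for $x<b$, $\Phi_i^b(x)=E_x(\rho^{\tau_b}\mathbf 1_{G_i^b})$ (the integrand being $0$ on $\{\tau_b=\infty\}$), $i=1,\dots,m$. *)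

theory Defs
  imports "HOL-Probability.Probability" "HOL-Library.Extended_Nat"
begin

subsection \<open>Matrices\<close>

definition matrix_power :: "real^'n^'n \<Rightarrow> nat \<Rightarrow> real^'n^'n" where
  "matrix_power A n = ((**) A ^^ n) (mat 1)"

definition matrix_exp :: "real^'n^'n \<Rightarrow> real^'n^'n" where
  "matrix_exp A = (\<Sum>n. (1 / fact n) *\<^sub>R matrix_power A n)"

text \<open>Eigenvalues of a real matrix are taken in the complex numbers.\<close>

definition complex_eigenvalue :: "real^'n^'n \<Rightarrow> complex \<Rightarrow> bool" where
  "complex_eigenvalue A \<mu> \<longleftrightarrow> (\<exists>v::complex^'n. v \<noteq> 0 \<and> map_matrix complex_of_real A *v v = \<mu> *s v)"

definition probability_vector :: "real^'n \<Rightarrow> bool" where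
  "probability_vector p \<longleftrightarrow> (\<forall>i. 0 \<le> p $ i) \<and> (\<Sum>i\<in>UNIV. p $ i) = 1"

subsection \<open>Continuous-time Markov chains on a finite state space\<close>

definition generator_matrix :: "real^'s^'s \<Rightarrow> bool" where
  "generator_matrix G \<longleftrightarrow>
     (\<forall>i j. i \<noteq> j \<longrightarrow> 0 \<le> G $ i $ j) \<and> (\<forall>i. (\<Sum>j\<in>UNIV. G $ i $ j) = 0)"

text \<open>A right-continuous process whose finite-dimensional distributions are those given by the
  initial distribution \<open>p\<close> and the transition semigroup \<open>exp (t G)\<close>. Only times \<open>t \<ge> 0\<close> matter.\<close>

definition markov_chain ::
  "'a measure \<Rightarrow> real^'s^'s \<Rightarrow> real^'s \<Rightarrow> (real \<Rightarrow> 'a \<Rightarrow> 's) \<Rightarrow> bool" where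
  "markov_chain M G p J \<longleftrightarrow>
     prob_space M \<and>
     (\<forall>t\<ge>0. J t \<in> measurable M (count_space UNIV)) \<and>
     (\<forall>\<omega>\<in>space M. \<forall>t\<ge>0. \<exists>\<delta>>0. \<forall>s. t \<le> s \<and> s < t + \<delta> \<longrightarrow> J s \<omega> = J t \<omega>) \<and>
     (\<forall>(n::nat) (t::nat \<Rightarrow> real) (s::nat \<Rightarrow> 's).
        t 0 = 0 \<and> (\<forall>k<n. t k \<le> t (Suc k)) \<longrightarrow>
        measure M {\<omega> \<in> space M. \<forall>k\<le>n. J (t k) \<omega> = s k} =
          p $ s 0 * (\<Prod>k<n. matrix_exp ((t (Suc k) - t k) *\<^sub>R G) $ s k $ s (Suc k)))"

text \<open>Quantifying over laws on the path space \<open>real \<Rightarrow> 's\<close>, with the coordinate process, is no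
  restriction: any chain can be transported to its path space.\<close>

definition transient_state :: "real^'s^'s \<Rightarrow> 's \<Rightarrow> bool" where
  "transient_state G i \<longleftrightarrow>
     (\<forall>P::(real \<Rightarrow> 's) measure. markov_chain P G (axis i 1) (\<lambda>t \<omega>. \<omega> t) \<longrightarrow>
        (AE \<omega> in P. bounded {t. 0 \<le> t \<and> \<omega> t = i}))"

subsection \<open>Phasetype distributions\<close>

text \<open>The type \<open>'m\<close> plays the role of \<open>{1..m}\<close>; \<open>'m option\<close> adds the absorbing state
  \<open>\<Delta> = None\<close>.\<close>

definition hat_matrix :: "real^'m^'m \<Rightarrow> real^('m option)^('m option)" where
  "hat_matrix Q = (\<chi> i j. case i of None \<Rightarrow> 0
     | Some i' \<Rightarrow> (case j of None \<Rightarrow> - (\<Sum>k\<in>UNIV. Q $ i' $ k) | Some j' \<Rightarrow> Q $ i' $ j'))"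

definition hat_vector :: "real^'m \<Rightarrow> real^('m option)" where
  "hat_vector \<alpha> = (\<chi> i. case i of None \<Rightarrow> 0 | Some i' \<Rightarrow> \<alpha> $ i')"

definition phase_type_matrix :: "real^'m^'m \<Rightarrow> bool" where
  "phase_type_matrix Q \<longleftrightarrow>
     generator_matrix (hat_matrix Q) \<and> (\<forall>i. transient_state (hat_matrix Q) (Some i))"

text \<open>Finite for almost every path when all states \<open>Some i\<close> are transient; on the exceptional null
  set, where the path is never absorbed, the value is the arbitrary real \<open>Inf {}\<close>.\<close>

definition absorption_time :: "(real \<Rightarrow> 'm option) \<Rightarrow> real" where
  "absorption_time w = Inf {t. 0 \<le> t \<and> w t = None}"

definition phase_type_distribution :: "real^'m^'m \<Rightarrow> real^'m \<Rightarrow> real measure \<Rightarrow> bool" where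
  "phase_type_distribution Q \<alpha> \<mu> \<longleftrightarrow>
     (\<exists>P::(real \<Rightarrow> 'm option) measure.
        markov_chain P (hat_matrix Q) (hat_vector \<alpha>) (\<lambda>t \<omega>. \<omega> t) \<and>
        \<mu> = distr P borel absorption_time)"

subsection \<open>The autoregressive process\<close>

text \<open>The families \<open>J\<close> and \<open>T\<close> are used for indices \<open>n \<ge> 1\<close> only. In the independence assumption,
  \<open>Inl n\<close> stands for the sigma-algebra of the whole path of \<open>J n\<close> on \<open>[0,\<infinity>)\<close> and \<open>Inr n\<close> for that
  of \<open>T n\<close>.\<close>

locale phase_type_AR = prob_space M
  for M :: "'a measure" +
  fixes Q :: "real^'m^'m" and \<alpha> :: "real^'m" and lam :: real
    and J :: "nat \<Rightarrow> real \<Rightarrow> 'a \<Rightarrow> 'm option" and T :: "nat \<Rightarrow> 'a \<Rightarrow> real"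
  assumes lam: "0 < lam" "lam < 1"
    and phase_type_matrix: "phase_type_matrix Q"
    and probability_vector: "probability_vector \<alpha>"
    and chain: "\<And>n. 1 \<le> n \<Longrightarrow> markov_chain M (hat_matrix Q) (hat_vector \<alpha>) (J n)"
    and T_measurable: "\<And>n. 1 \<le> n \<Longrightarrow> T n \<in> borel_measurable M"
    and T_nonneg: "\<And>n \<omega>. 1 \<le> n \<Longrightarrow> \<omega> \<in> space M \<Longrightarrow> 0 \<le> T n \<omega>"
    and T_identically_distributed: "\<And>n. 1 \<le> n \<Longrightarrow> distr M borel (T n) = distr M borel (T 1)"
    and independent:
      "indep_sets
         (case_sum
           (\<lambda>n. {(\<lambda>\<omega>. \<lambda>t\<in>{0..}. J n t \<omega>) -` A \<inter> space M | A.
                   A \<in> sets (PiM {0..} (\<lambda>_. count_space UNIV))})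
           (\<lambda>n. {T n -` A \<inter> space M | A. A \<in> sets borel}))
         ({1..} <+> {1..})"
    and log_moment:
      "integrable M (\<lambda>\<omega>. ln (1 + \<bar>absorption_time (\<lambda>t. J 1 t \<omega>) - T 1 \<omega>\<bar>))"
    and no_common_eigenvalue:
      "\<And>n::nat. 1 \<le> n \<Longrightarrow>
         \<not> (\<exists>\<mu>. complex_eigenvalue ((lam ^ n) *\<^sub>R Q) \<mu> \<and> complex_eigenvalue Q \<mu>)"
begin

definition S :: "nat \<Rightarrow> 'a \<Rightarrow> real" where
  "S n \<omega> = absorption_time (\<lambda>t. J n t \<omega>)"

definition Z :: "nat \<Rightarrow> 'a \<Rightarrow> real" where
  "Z n \<omega> = S n \<omega> - T n \<omega>"

text \<open>The law \<open>P_x\<close> is rendered by starting the recursion in \<open>x\<close>, under the one measure \<open>M\<close>.\<close>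

primrec X :: "real \<Rightarrow> nat \<Rightarrow> 'a \<Rightarrow> real" where
  "X x 0 \<omega> = x"
| "X x (Suc n) \<omega> = lam * X x n \<omega> + Z (Suc n) \<omega>"

definition filt :: "enat \<Rightarrow> 'a measure" where
  "filt t = sigma (space M)
     {Z k -` A \<inter> space M | k A. 1 \<le> k \<and> enat k \<le> t \<and> A \<in> sets borel}"

definition expected_payoff :: "real \<Rightarrow> (real \<Rightarrow> real) \<Rightarrow> real \<Rightarrow> ('a \<Rightarrow> enat) \<Rightarrow> ennreal" where
  "expected_payoff \<rho> g x \<tau> =
     (\<integral>\<^sup>+\<omega>. (case \<tau> \<omega> of enat n \<Rightarrow> ennreal (\<rho> ^ n * g (X x n \<omega>)) | \<infinity> \<Rightarrow> 0) \<partial>M)"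

definition v :: "real \<Rightarrow> (real \<Rightarrow> real) \<Rightarrow> real \<Rightarrow> ennreal" where
  "v \<rho> g x = (SUP \<tau>\<in>{\<tau>. stopping_time filt \<tau>}. expected_payoff \<rho> g x \<tau>)"

definition optimal_stopping_set :: "real \<Rightarrow> (real \<Rightarrow> real) \<Rightarrow> real set" where
  "optimal_stopping_set \<rho> g = {x. v \<rho> g x = ennreal (g x)}"

definition \<tau> :: "real \<Rightarrow> real \<Rightarrow> 'a \<Rightarrow> enat" where
  "\<tau> b x \<omega> = (INF n\<in>{n. b \<le> X x n \<omega>}. enat n)"

definition n\<^sub>t :: "real \<Rightarrow> 'a \<Rightarrow> nat" where
  "n\<^sub>t t \<omega> = Max {n. (\<Sum>k=1..n. S k \<omega>) \<le> t}"

definition J\<^sub>t :: "real \<Rightarrow> 'a \<Rightarrow> 'm option" where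
  "J\<^sub>t t \<omega> = J (n\<^sub>t t \<omega> + 1) (t - (\<Sum>k=1..n\<^sub>t t \<omega>. S k \<omega>)) \<omega>"

definition Y :: "real \<Rightarrow> real \<Rightarrow> 'a \<Rightarrow> real" where
  "Y x t \<omega> = lam * X x (n\<^sub>t t \<omega>) \<omega> - T (n\<^sub>t t \<omega> + 1) \<omega> + t - (\<Sum>k=1..n\<^sub>t t \<omega>. S k \<omega>)"

definition \<tau>_hat :: "real \<Rightarrow> real \<Rightarrow> 'a \<Rightarrow> ereal" where
  "\<tau>_hat b x \<omega> = (INF t\<in>{t. 0 \<le> t \<and> b \<le> Y x t \<omega>}. ereal t)"

definition G :: "'m \<Rightarrow> real \<Rightarrow> real \<Rightarrow> 'a set" where
  "G i b x = {\<omega> \<in> space M. \<tau>_hat b x \<omega> < \<infinity> \<and> J\<^sub>t (real_of_ereal (\<tau>_hat b x \<omega>)) \<omega> = Some i}"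

text \<open>The nonnegative integral is used because \<open>G i b x\<close> is only measurable up to a null set, which
  arises where some path is never absorbed or where infinitely many partial sums of \<open>S\<close> stay
  below some \<open>t\<close>, so that \<open>Inf\<close> and \<open>Max\<close> take arbitrary values. The values lie in \<open>[0,1]\<close>.\<close>

definition \<Phi> :: "real \<Rightarrow> 'm \<Rightarrow> real \<Rightarrow> real \<Rightarrow> ennreal" where
  "\<Phi> \<rho> i b x =
     (\<integral>\<^sup>+\<omega>. (case \<tau> b x \<omega> of enat n \<Rightarrow> ennreal (\<rho> ^ n) | \<infinity> \<Rightarrow> 0) * indicator (G i b x) \<omega> \<partial>M)"

end

end

theory Submission
  imports Defs
begin

text \<open>When \<open>X\<close> first reaches or exceeds a threshold \<open>c\<close> from below, it does so during the
  absorption time \<open>S\<close> of one of the chains: the crossing happens as soon as \<open>S\<close> exceeds a random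
  level that is determined by the past and by the present \<open>T\<close>, hence is independent of that chain.
  Given the state \<open>i\<close> of the chain when its clock passes the level, the remaining time to absorption
  is again phasetype, now started in \<open>i\<close> (\<open>nn_integral_residual\<close>). This remaining time is the
  overshoot, so for \<open>x < c\<close> the payoff of the rule \<open>\<tau> c x\<close> is
  \<open>(\<Sum>i. \<Phi> \<rho> i c x * E (g (c + R i)))\<close> (\<open>expected_payoff_threshold\<close>).

  Take \<open>c = b\<close> and a start below \<open>b\<close>: by optimality the sum is the value there. Take \<open>c = b + \<epsilon>\<close>
  and the start \<open>b\<close>: the sum is the payoff of an admissible rule and so at most \<open>v b = g b\<close>. By the
  two limit hypotheses both sums have the same limit, which is thus at most \<open>g b\<close>. It is at least
  \<open>g b\<close>, because stopping at once gives \<open>v \<ge> g\<close> and \<open>g\<close> is continuous.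

  Passing to the limit in a product requires that a vanishing \<open>\<Phi>\<close> does not meet an infinite
  expectation. States that the chain cannot reach have \<open>\<Phi> = 0\<close> throughout. If \<open>i\<close> is reachable, it
  carries mass at every positive time (\<open>law_at_zero_imp_zero\<close>), and so do all its successors. They
  occur as crossing states of the threshold \<open>b + 1\<close> from the start \<open>b\<close>, where the value is finite;
  hence \<open>E (g (b + 1 + R j))\<close> is finite for each of them, and restarting the chain from \<open>i\<close> after
  one unit of time transfers this to \<open>E (g (b + R i))\<close>, as \<open>g\<close> is bounded on \<open>{b..b + 1}\<close>
  (\<open>nn_integral_reachable_finite\<close>).

  The overshoot can be read off from the paths only if almost every path is absorbed. Transience
  gives this by a cycle argument on the finite state space (\<open>absorption_possible\<close>).\<close>

section \<open>The matrix exponential, entry by entry\<close>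

lemma matrix_power_0: "matrix_power A 0 = mat 1"
  and matrix_power_Suc: "matrix_power A (Suc n) = A ** matrix_power A n"
  by (simp_all add: matrix_power_def)

lemma matrix_power_scaleR: "matrix_power (t *\<^sub>R A) n = t ^ n *\<^sub>R matrix_power A n"
proof (induction n)
  case (Suc n)
  show ?case
    unfolding matrix_power_Suc Suc.IH
    by (vector matrix_matrix_mult_def) (simp add: sum_distrib_left mult_ac)
qed (simp add: matrix_power_0)

lemma abs_matrix_power_le:
  fixes A :: "real^'n^'n"
  shows "\<bar>matrix_power A n $ i $ j\<bar> \<le> (\<Sum>k\<in>UNIV. \<Sum>l\<in>UNIV. \<bar>A $ k $ l\<bar>) ^ n"
proof (induction n arbitrary: i)
  case 0
  then show ?case by (simp add: matrix_power_0 mat_def)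
next
  case (Suc n)
  let ?K = "\<Sum>k\<in>UNIV. \<Sum>l\<in>UNIV. \<bar>A $ k $ l\<bar>"
  have K: "0 \<le> ?K" by (simp add: sum_nonneg)
  have "\<bar>matrix_power A (Suc n) $ i $ j\<bar> \<le> (\<Sum>k\<in>UNIV. \<bar>A $ i $ k * matrix_power A n $ k $ j\<bar>)"
    by (simp add: matrix_power_Suc matrix_matrix_mult_def)
  also have "\<dots> \<le> (\<Sum>k\<in>UNIV. \<bar>A $ i $ k\<bar> * ?K ^ n)"
    by (intro sum_mono) (simp add: abs_mult Suc.IH mult_left_mono)
  also have "\<dots> = (\<Sum>k\<in>UNIV. \<bar>A $ i $ k\<bar>) * ?K ^ n"
    by (simp add: sum_distrib_right)
  also have "\<dots> \<le> ?K * ?K ^ n"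
    by (intro mult_right_mono member_le_sum[where f="\<lambda>k. \<Sum>l\<in>UNIV. \<bar>A $ k $ l\<bar>"])
      (auto intro: sum_nonneg zero_le_power[OF K])
  finally show ?case by simp
qed

lemma summable_matrix_exp_entry:
  fixes A :: "real^'n^'n"
  shows "summable (\<lambda>n. matrix_power A n $ i $ j / fact n * t ^ n)"
proof (rule summable_comparison_test')
  let ?K = "\<Sum>k\<in>UNIV. \<Sum>l\<in>UNIV. \<bar>A $ k $ l\<bar>"
  show "summable (\<lambda>n. (?K * \<bar>t\<bar>) ^ n / fact n)"
    using summable_exp[of "?K * \<bar>t\<bar>"] by (simp add: field_simps)
  show "norm (matrix_power A n $ i $ j / fact n * t ^ n) \<le> (?K * \<bar>t\<bar>) ^ n / fact n" for n
    using mult_right_mono[OF abs_matrix_power_le[of A n i j], of "\<bar>t\<bar> ^ n / fact n"]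
    by (simp add: power_mult_distrib abs_mult power_abs)
qed

lemma matrix_exp_entry_sums:
  fixes A :: "real^'n^'n"
  shows "(\<lambda>n. matrix_power A n $ i $ j / fact n * t ^ n) sums (matrix_exp (t *\<^sub>R A) $ i $ j)"
proof -
  let ?f = "\<lambda>n. (1 / fact n) *\<^sub>R matrix_power (t *\<^sub>R A) n"
  have entry: "?f n $ i $ j = matrix_power A n $ i $ j / fact n * t ^ n" for n i j
    by (simp add: matrix_power_scaleR)
  have "(\<lambda>N. \<Sum>n<N. ?f n) \<longlonglongrightarrow> (\<chi> i j. \<Sum>n. matrix_power A n $ i $ j / fact n * t ^ n)"
    using summable_LIMSEQ[OF summable_matrix_exp_entry[of A _ _ t]]
    by (intro vec_tendstoI) (simp only: sum_component entry vec_lambda_beta)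
  then have "?f sums (\<chi> i j. \<Sum>n. matrix_power A n $ i $ j / fact n * t ^ n)"
    by (simp only: sums_def)
  then have "matrix_exp (t *\<^sub>R A) = (\<chi> i j. \<Sum>n. matrix_power A n $ i $ j / fact n * t ^ n)"
    unfolding matrix_exp_def by (simp only: sums_unique[symmetric])
  then show ?thesis
    using summable_sums[OF summable_matrix_exp_entry[of A i j t]] by simp
qed

lemma isCont_matrix_exp_entry:
  fixes A :: "real^'n^'n"
  shows "isCont (\<lambda>t. matrix_exp (t *\<^sub>R A) $ i $ j) t"
proof -
  have eq: "(\<lambda>t. matrix_exp (t *\<^sub>R A) $ i $ j) = (\<lambda>t. \<Sum>n. matrix_power A n $ i $ j / fact n * t ^ n)"
    using sums_unique[OF matrix_exp_entry_sums] by blast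
  show ?thesis
    unfolding eq
    by (rule isCont_powser_converges_everywhere) (rule summable_matrix_exp_entry)
qed

lemma matrix_exp_0: "matrix_exp (0 :: real^'n^'n) $ i $ j = (if i = j then 1 else 0)"
proof -
  define A :: "real^'n^'n" where "A = 0"
  have "(\<lambda>n. matrix_power A n $ i $ j / fact n * 0 ^ n) sums (mat 1 $ i $ j)"
    using sums_single[of 0 "\<lambda>_. mat 1 $ i $ j :: real"]
    by (rule sums_cong[THEN iffD1, rotated]) (simp add: matrix_power_0)
  then show ?thesis
    using sums_unique2[OF matrix_exp_entry_sums[of A i j 0]] by (simp add: mat_def)
qed

lemma matrix_exp_zero_row:
  fixes A :: "real^'n^'n"
  assumes "\<And>k. A $ i $ k = 0"
  shows "matrix_exp (t *\<^sub>R A) $ i $ j = (if i = j then 1 else 0)"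
proof -
  have z: "matrix_power A n $ i $ j = 0" if n: "n > 0" for n
    using n assms by (cases n) (auto simp: matrix_power_Suc matrix_matrix_mult_def)
  have "(\<lambda>n. matrix_power A n $ i $ j / fact n * t ^ n) sums (mat 1 $ i $ j)"
    using sums_single[of 0 "\<lambda>_. mat 1 $ i $ j :: real"]
    by (rule sums_cong[THEN iffD1, rotated]) (simp add: matrix_power_0 z)
  then show ?thesis
    using sums_unique2[OF matrix_exp_entry_sums[of A i j t]] by (simp add: mat_def)
qed

text \<open>Dividing the series by \<open>t ^ n\<close> and letting \<open>t \<rightarrow> 0\<close> identifies one coefficient after the other.\<close>

lemma powser_coeffs_zero:
  fixes c :: "nat \<Rightarrow> real"
  assumes c: "\<And>t. summable (\<lambda>n. c n * t ^ n)"
    and s: "0 < s" and z: "\<And>t. 0 \<le> t \<Longrightarrow> t \<le> s \<Longrightarrow> (\<Sum>n. c n * t ^ n) = 0"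
  shows "c n = 0"
proof (induction n rule: less_induct)
  case (less n)
  let ?h = "\<lambda>t. \<Sum>k. c (k + n) * t ^ k"
  have summ: "summable (\<lambda>k. c (k + n) * t ^ k)" for t
  proof (cases "t = 0")
    case True
    then show ?thesis
      by (intro summable_finite[of "{0}"]) auto
  next
    case False
    have "summable (\<lambda>k. c (k + n) * t ^ (k + n))"
      by (rule summable_ignore_initial_segment[OF c])
    then have "summable (\<lambda>k. inverse (t ^ n) * (c (k + n) * t ^ (k + n)))"
      by (rule summable_mult)
    then show ?thesis
      using False by (simp add: power_add field_simps)
  qed
  have h0: "?h t = 0" if t: "0 < t" "t \<le> s" for t
  proof -
    have "0 = (\<Sum>k. c (k + n) * t ^ (k + n)) + (\<Sum>k<n. c k * t ^ k)"
      using suminf_split_initial_segment[OF c, of t n] z[of t] t by simp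
    also have "(\<Sum>k<n. c k * t ^ k) = 0"
      using less.IH by simp
    also have "(\<Sum>k. c (k + n) * t ^ (k + n)) = (\<Sum>k. t ^ n * (c (k + n) * t ^ k))"
      by (simp add: power_add mult_ac)
    also have "\<dots> = t ^ n * ?h t"
      by (rule suminf_mult[OF summ])
    finally show ?thesis using t by simp
  qed
  have "isCont ?h 0"
    by (rule isCont_powser_converges_everywhere) (rule summ)
  then have "(?h \<longlongrightarrow> ?h 0) (at_right 0)"
    by (simp add: isCont_def filterlim_at_split)
  moreover have "(?h \<longlongrightarrow> 0) (at_right 0)"
  proof (rule tendsto_eventually)
    show "\<forall>\<^sub>F t in at_right 0. ?h t = 0"
      unfolding eventually_at_right_field using s h0 by (intro exI[of _ s]) auto
  qed
  ultimately have "?h 0 = 0"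
    by (rule tendsto_unique[rotated]) simp
  moreover have "?h 0 = c n"
    using suminf_finite[of "{0}" "\<lambda>k. c (k + n) * 0 ^ k"] by auto
  ultimately show ?case by simp
qed

section \<open>The transition function of a phasetype chain\<close>

lemma (in finite_measure) sum_measure_fibers:
  fixes X :: "'a \<Rightarrow> 's::finite"
  assumes A: "A \<in> sets M" and X: "X \<in> measurable M (count_space UNIV)"
  shows "(\<Sum>j\<in>UNIV. measure M (A \<inter> {\<omega>\<in>space M. X \<omega> = j})) = measure M A"
proof -
  have "measure M (\<Union>j\<in>UNIV. A \<inter> {\<omega>\<in>space M. X \<omega> = j}) = (\<Sum>j\<in>UNIV. measure M (A \<inter> {\<omega>\<in>space M. X \<omega> = j}))"
    using A X by (intro finite_measure_finite_Union) (auto simp: disjoint_family_on_def)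
  moreover have "(\<Union>j\<in>UNIV. A \<inter> {\<omega>\<in>space M. X \<omega> = j}) = A"
    using sets.sets_into_space[OF A] by auto
  ultimately show ?thesis by simp
qed

definition law_at :: "real^'s^'s \<Rightarrow> real^'s \<Rightarrow> real \<Rightarrow> 's \<Rightarrow> real" where
  "law_at G p t j = (\<Sum>a\<in>UNIV. p $ a * matrix_exp (t *\<^sub>R G) $ a $ j)"

lemma law_at_axis: "law_at G (axis i 1) t j = matrix_exp (t *\<^sub>R G) $ i $ j"
proof -
  have "law_at G (axis i 1) t j = (\<Sum>a\<in>UNIV. if a = i then matrix_exp (t *\<^sub>R G) $ a $ j else 0)"
    unfolding law_at_def by (intro sum.cong) (auto simp: axis_def)
  then show ?thesis by simp
qed

lemma isCont_law_at: "isCont (\<lambda>t. law_at G p t j) t"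
  unfolding law_at_def by (intro continuous_intros isCont_matrix_exp_entry)

lemma markov_chain_two_times:
  assumes mc: "markov_chain M G p J" and t: "0 \<le> t" "t \<le> u"
  shows "measure M {\<omega>\<in>space M. J t \<omega> = i \<and> J u \<omega> = j} =
    law_at G p t i * matrix_exp ((u - t) *\<^sub>R G) $ i $ j"
proof -
  interpret prob_space M using mc by (simp add: markov_chain_def)
  have J [measurable]: "J t \<in> measurable M (count_space UNIV)" if "0 \<le> t" for t
    using mc that by (simp add: markov_chain_def)
  have fdd: "measure M {\<omega>\<in>space M. \<forall>k\<le>n. J (t k) \<omega> = s k} =
      p $ s 0 * (\<Prod>k<n. matrix_exp ((t (Suc k) - t k) *\<^sub>R G) $ s k $ s (Suc k))"
    if "t 0 = 0" "\<forall>k<n. t k \<le> t (Suc k)" for n t s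
    using mc that unfolding markov_chain_def by blast
  define A where "A = {\<omega>\<in>space M. J t \<omega> = i \<and> J u \<omega> = j}"
  have A: "A \<in> sets M"
    unfolding A_def using J[OF t(1)] J[of u] t by simp
  have *: "measure M (A \<inter> {\<omega>\<in>space M. J 0 \<omega> = a}) =
      p $ a * matrix_exp (t *\<^sub>R G) $ a $ i * matrix_exp ((u - t) *\<^sub>R G) $ i $ j" for a
  proof -
    let ?t = "\<lambda>k::nat. if k = 0 then 0 else if k = 1 then t else u"
    let ?s = "\<lambda>k::nat. if k = 0 then a else if k = 1 then i else j"
    have "A \<inter> {\<omega>\<in>space M. J 0 \<omega> = a} = {\<omega>\<in>space M. \<forall>k\<le>2. J (?t k) \<omega> = ?s k}"
      unfolding A_def by (auto simp: numeral_2_eq_2 le_Suc_eq)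
    then have "measure M (A \<inter> {\<omega>\<in>space M. J 0 \<omega> = a}) = 
        p $ a * (\<Prod>k<2. matrix_exp ((?t (Suc k) - ?t k) *\<^sub>R G) $ ?s k $ ?s (Suc k))"
      using fdd[of ?t 2 ?s] t by simp
    then show ?thesis by (simp add: numeral_2_eq_2)
  qed
  have "measure M A = (\<Sum>a\<in>UNIV. measure M (A \<inter> {\<omega>\<in>space M. J 0 \<omega> = a}))"
    using sum_measure_fibers[OF A J[OF order_refl]] by simp
  also have "\<dots> = law_at G p t i * matrix_exp ((u - t) *\<^sub>R G) $ i $ j"
    unfolding * law_at_def by (simp add: sum_distrib_right)
  finally show ?thesis by (simp add: A_def)
qed

lemma markov_chain_one_time:
  assumes mc: "markov_chain M G p J" and t: "0 \<le> t"
  shows "measure M {\<omega>\<in>space M. J t \<omega> = i} = law_at G p t i"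
  using markov_chain_two_times[OF mc t order_refl, of i i] by (simp add: matrix_exp_0)

lemma markov_chain_law_sum:
  assumes mc: "markov_chain M G p J" and t: "0 \<le> t"
  shows "(\<Sum>i\<in>UNIV. law_at G p t i) = 1"
proof -
  interpret prob_space M using mc by (simp add: markov_chain_def)
  have J: "J t \<in> measurable M (count_space UNIV)"
    using mc t by (simp add: markov_chain_def)
  have "space M \<inter> {\<omega>\<in>space M. P \<omega>} = {\<omega>\<in>space M. P \<omega>}" for P by auto
  then show ?thesis
    using sum_measure_fibers[OF sets.top J] markov_chain_one_time[OF mc t] by (simp add: prob_space)
qed

text \<open>Nonnegativity, the Chapman-Kolmogorov equation and unit row sums of \<open>exp (t Q)\<close> are read off
  from the chain that starts in the row in question, so that no commutation rule for matrix
  exponentials is involved. The existence of these chains is therefore part of the locale; it also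
  keeps transience, which quantifies over all such chains, from being vacuous.\<close>

locale phase_type_kernel =
  fixes Q :: "real^'m^'m"
  assumes phase_type: "phase_type_matrix Q"
    and chain_exists: "\<exists>P::(real \<Rightarrow> 'm option) measure.
      markov_chain P (hat_matrix Q) (axis (Some i) 1) (\<lambda>t \<omega>. \<omega> t)"
begin

definition tr :: "real \<Rightarrow> 'm option \<Rightarrow> 'm option \<Rightarrow> real" where
  "tr t i j = matrix_exp (t *\<^sub>R hat_matrix Q) $ i $ j"

lemma tr_0: "tr 0 i j = (if i = j then 1 else 0)"
  unfolding tr_def by (simp add: matrix_exp_0)

lemma tr_None: "tr t None j = (if j = None then 1 else 0)"
  unfolding tr_def by (subst matrix_exp_zero_row) (auto simp: hat_matrix_def)

lemma isCont_tr: "isCont (\<lambda>t. tr t i j) t"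
  unfolding tr_def by (rule isCont_matrix_exp_entry)

lemma tr_nonneg: "0 \<le> t \<Longrightarrow> 0 \<le> tr t i j"
proof (cases i)
  case (Some a)
  assume "0 \<le> t"
  moreover obtain P :: "(real \<Rightarrow> 'm option) measure"
    where P: "markov_chain P (hat_matrix Q) (axis (Some a) 1) (\<lambda>t \<omega>. \<omega> t)"
    using chain_exists by blast
  ultimately show ?thesis
    using markov_chain_one_time[OF P, of t j] measure_nonneg[of P "{\<omega> \<in> space P. \<omega> t = j}"] Some
    by (simp add: law_at_axis tr_def)
qed (simp add: tr_None)

lemma tr_sum: "0 \<le> t \<Longrightarrow> (\<Sum>j\<in>UNIV. tr t i j) = 1"
proof (cases i)
  case (Some a)
  assume "0 \<le> t"
  moreover obtain P :: "(real \<Rightarrow> 'm option) measure"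
    where P: "markov_chain P (hat_matrix Q) (axis (Some a) 1) (\<lambda>t \<omega>. \<omega> t)"
    using chain_exists by blast
  ultimately show ?thesis
    using markov_chain_law_sum[OF P, of t] Some by (simp add: law_at_axis tr_def)
qed (simp add: tr_None)

lemma tr_sum_Some: "0 \<le> t \<Longrightarrow> (\<Sum>j\<in>UNIV. tr t i (Some j)) = 1 - tr t i None"
  using tr_sum[of t i] by (simp add: UNIV_option_conv sum.reindex)

lemma law_at_add:
  assumes mc: "markov_chain M (hat_matrix Q) p J" and t: "0 \<le> s" "0 \<le> t"
  shows "law_at (hat_matrix Q) p (s + t) j = (\<Sum>k\<in>UNIV. law_at (hat_matrix Q) p s k * tr t k j)"
proof -
  interpret prob_space M using mc by (simp add: markov_chain_def)
  have J [measurable]: "J t \<in> measurable M (count_space UNIV)" if "0 \<le> t" for t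
    using mc that by (simp add: markov_chain_def)
  define A where "A = {\<omega>\<in>space M. J (s + t) \<omega> = j}"
  have A: "A \<in> sets M"
    unfolding A_def using J[of "s + t"] t by simp
  have "law_at (hat_matrix Q) p (s + t) j = measure M A"
    unfolding A_def using t by (subst markov_chain_one_time[OF mc]) auto
  also have "\<dots> = (\<Sum>k\<in>UNIV. measure M (A \<inter> {\<omega>\<in>space M. J s \<omega> = k}))"
    using sum_measure_fibers[OF A J[OF t(1)]] by simp
  also have "\<dots> = (\<Sum>k\<in>UNIV. law_at (hat_matrix Q) p s k * tr t k j)"
  proof (intro sum.cong refl)
    fix k
    have "A \<inter> {\<omega>\<in>space M. J s \<omega> = k} = {\<omega>\<in>space M. J s \<omega> = k \<and> J (s + t) \<omega> = j}"
      by (auto simp: A_def)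
    then show "measure M (A \<inter> {\<omega>\<in>space M. J s \<omega> = k}) = law_at (hat_matrix Q) p s k * tr t k j"
      using markov_chain_two_times[OF mc t(1), of "s + t" k j] t by (simp add: tr_def)
  qed
  finally show ?thesis .
qed

lemma tr_add:
  assumes t: "0 \<le> s" "0 \<le> t"
  shows "tr (s + t) i j = (\<Sum>k\<in>UNIV. tr s i k * tr t k j)"
proof (cases i)
  case None
  then show ?thesis by (simp add: tr_None if_distrib[of "\<lambda>x. x * _"] cong: if_cong)
next
  case (Some a)
  moreover obtain P :: "(real \<Rightarrow> 'm option) measure"
    where P: "markov_chain P (hat_matrix Q) (axis (Some a) 1) (\<lambda>t \<omega>. \<omega> t)"
    using chain_exists by blast
  ultimately show ?thesis
    using law_at_add[OF P t, of j] by (simp add: law_at_axis tr_def)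
qed

lemma tr_add_ge:
  assumes "0 \<le> s" "0 \<le> t"
  shows "tr s i k * tr t k j \<le> tr (s + t) i j"
  unfolding tr_add[OF assms]
  using assms by (intro member_le_sum[of k UNIV "\<lambda>k. tr s i k * tr t k j"]) (auto simp: tr_nonneg)

lemma tr_le_1: "0 \<le> t \<Longrightarrow> tr t i j \<le> 1"
  using member_le_sum[of j UNIV "\<lambda>j. tr t i j"] tr_sum[of t i] by (simp add: tr_nonneg)

section \<open>Absorption\<close>

lemma tr_diag_tendsto_0: "(\<lambda>n. tr (real n) (Some i) (Some i)) \<longlonglongrightarrow> 0"
proof -
  obtain P :: "(real \<Rightarrow> 'm option) measure"
    where P: "markov_chain P (hat_matrix Q) (axis (Some i) 1) (\<lambda>t \<omega>. \<omega> t)"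
    using chain_exists by blast
  interpret prob_space P using P by (simp add: markov_chain_def)
  have coord: "(\<lambda>\<omega>. \<omega> t) \<in> measurable P (count_space UNIV)" if "0 \<le> t" for t
    using P that by (simp add: markov_chain_def)
  let ?A = "\<lambda>n::nat. {\<omega>\<in>space P. \<omega> (real n) = Some i}"
  have A: "?A n \<in> sets P" for n
    using coord[of "real n"] by simp
  have ae: "AE \<omega> in P. bounded {t. 0 \<le> t \<and> \<omega> t = Some i}"
    using phase_type P unfolding phase_type_matrix_def transient_state_def by blast
  have "(\<lambda>n. \<integral>\<omega>. indicator (?A n) \<omega> \<partial>P) \<longlonglongrightarrow> (\<integral>\<omega>. 0 \<partial>P :: real)"
  proof (rule integral_dominated_convergence[where w="\<lambda>_. 1"])
    show "AE \<omega> in P. (\<lambda>n. indicator (?A n) \<omega>) \<longlonglongrightarrow> (0::real)"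
      using ae
    proof eventually_elim
      case (elim \<omega>)
      then obtain a where a: "\<And>t. 0 \<le> t \<Longrightarrow> \<omega> t = Some i \<Longrightarrow> t \<le> a"
        by (auto simp: bounded_real)
      obtain N where N: "a < real N" using reals_Archimedean2 by blast
      have "indicator (?A n) \<omega> = (0::real)" if "N \<le> n" for n
      proof -
        have "\<not> real n \<le> a" using N that by simp
        then have "\<omega> (real n) \<noteq> Some i" using a[of "real n"] by auto
        then show ?thesis by simp
      qed
      then show ?case
        by (intro tendsto_eventually eventually_sequentiallyI[of N])
    qed
  qed (use A in \<open>auto simp: indicator_def\<close>)
  then have "(\<lambda>n. measure P (?A n)) \<longlonglongrightarrow> 0"
    using A by simp
  then show ?thesis
    using markov_chain_one_time[OF P, of "real _" "Some i"] by (simp add: law_at_axis tr_def)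
qed

text \<open>Transience bounds only the visits to the starting state. If absorption were impossible from
  \<open>i\<close>, each state of the closed set of such states would keep a non-vanishing mass on some state
  of that set. Following such links in a finite set runs into a cycle, and a state on the cycle
  would keep a non-vanishing mass on itself.\<close>

lemma absorption_possible: "\<exists>n. 0 < tr (real n) (Some i) None"
proof (rule ccontr)
  assume neg: "\<not> ?thesis"
  define C where "C = {i. \<forall>n. tr (real n) (Some i) None = 0}"
  have iC: "i \<in> C"
    using neg tr_nonneg[of "real _" "Some i" None] by (auto simp: C_def intro: antisym simp: not_less)
  have step: "\<exists>j\<in>C. \<not> (\<lambda>n. tr (real n) (Some a) (Some j)) \<longlonglongrightarrow> 0" if a: "a \<in> C" for a
  proof -
    have "\<exists>j. \<not> (\<lambda>n. tr (real n) (Some a) (Some j)) \<longlonglongrightarrow> 0"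
    proof (rule ccontr)
      assume "\<not> ?thesis"
      then have "(\<lambda>n. \<Sum>j\<in>UNIV. tr (real n) (Some a) (Some j)) \<longlonglongrightarrow> (\<Sum>j\<in>(UNIV::'m set). 0)"
        by (intro tendsto_sum) auto
      moreover have "(\<Sum>j\<in>UNIV. tr (real n) (Some a) (Some j)) = 1" for n
        using a by (simp add: tr_sum_Some C_def)
      ultimately show False
        by (simp add: LIMSEQ_const_iff)
    qed
    then obtain j where j: "\<not> (\<lambda>n. tr (real n) (Some a) (Some j)) \<longlonglongrightarrow> 0" ..
    then obtain n0 where "tr (real n0) (Some a) (Some j) \<noteq> 0"
      by (metis (no_types, lifting) LIMSEQ_const_iff ext)
    then have pos: "0 < tr (real n0) (Some a) (Some j)"
      using tr_nonneg[of "real n0" "Some a" "Some j"] by simp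
    have "j \<in> C"
      unfolding C_def
    proof (intro CollectI allI)
      fix n
      have "tr (real n0) (Some a) (Some j) * tr (real n) (Some j) None \<le> tr (real (n0 + n)) (Some a) None"
        using tr_add_ge[of "real n0" "real n"] by simp
      also have "\<dots> = 0" using a by (simp only: C_def mem_Collect_eq)
      finally have "tr (real n) (Some j) None \<le> 0"
        using pos by (simp add: mult_le_0_iff)
      then show "tr (real n) (Some j) None = 0"
        using tr_nonneg[of "real n"] by (intro antisym) auto
    qed
    then show ?thesis using j by blast
  qed
  then obtain f where f: "\<And>a. a \<in> C \<Longrightarrow> f a \<in> C"
      "\<And>a. a \<in> C \<Longrightarrow> \<not> (\<lambda>n. tr (real n) (Some a) (Some (f a))) \<longlonglongrightarrow> 0"
    by metis
  have inC: "(f ^^ k) i \<in> C" for k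
    by (induction k) (auto simp: iC f)
  have "\<not> inj (\<lambda>k. (f ^^ k) i)"
    using finite_imageD[of "\<lambda>k. (f ^^ k) i" UNIV] by auto
  then obtain k l where kl: "k < l" "(f ^^ k) i = (f ^^ l) i"
    unfolding inj_def by (metis linorder_neqE_nat)
  define a where "a = (f ^^ k) i"
  have aC: "a \<in> C" by (simp add: a_def inC)
  have cyc: "f ((f ^^ (l - k - 1)) a) = a"
  proof -
    have "f ((f ^^ (l - k - 1)) a) = (f ^^ (Suc (l - k - 1) + k)) i"
      by (simp add: a_def funpow_add)
    also have "Suc (l - k - 1) + k = l" using kl by simp
    finally show ?thesis using kl by (simp add: a_def)
  qed
  have inC': "(f ^^ r) a \<in> C" for r
    by (induction r) (auto simp: aC f)
  have reach: "\<exists>n. 0 < tr (real n) (Some a) (Some ((f ^^ r) a))" for r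
  proof (induction r)
    case 0
    then show ?case by (intro exI[of _ 0]) (simp add: tr_0)
  next
    case (Suc r)
    let ?b = "(f ^^ r) a"
    obtain n where n: "0 < tr (real n) (Some a) (Some ?b)" using Suc by blast
    obtain n' where "tr (real n') (Some ?b) (Some (f ?b)) \<noteq> 0"
      using f(2)[OF inC'[of r]] by (metis (no_types, lifting) LIMSEQ_const_iff ext)
    then have n': "0 < tr (real n') (Some ?b) (Some (f ?b))"
      using tr_nonneg[of "real n'" "Some ?b" "Some (f ?b)"] by simp
    have "0 < tr (real n) (Some a) (Some ?b) * tr (real n') (Some ?b) (Some (f ?b))"
      using n n' by simp
    also have "\<dots> \<le> tr (real (n + n')) (Some a) (Some (f ?b))"
      using tr_add_ge[of "real n" "real n'"] by simp
    finally have "0 < tr (real (n + n')) (Some a) (Some (f ?b))" .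
    then show ?case by (intro exI[of _ "n + n'"]) simp
  qed
  define b where "b = (f ^^ (l - k - 1)) a"
  obtain n0 where n0: "0 < tr (real n0) (Some a) (Some b)"
    using reach[of "l - k - 1"] by (auto simp: b_def)
  have "(\<lambda>n. tr (real n) (Some b) (Some a)) \<longlonglongrightarrow> 0"
  proof (rule tendsto_sandwich[where f="\<lambda>_. 0" and h="\<lambda>n. tr (real (n + n0)) (Some a) (Some a) / tr (real n0) (Some a) (Some b)"])
    have "tr (real n) (Some b) (Some a) * tr (real n0) (Some a) (Some b) \<le> tr (real (n + n0)) (Some a) (Some a)" for n
      using tr_add_ge[of "real n0" "real n" "Some a" "Some b" "Some a"] by (simp add: ac_simps)
    then show "\<forall>\<^sub>F n in sequentially. tr (real n) (Some b) (Some a)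
        \<le> tr (real (n + n0)) (Some a) (Some a) / tr (real n0) (Some a) (Some b)"
      using n0 by (intro always_eventually allI) (simp only: pos_le_divide_eq)
    show "(\<lambda>n. tr (real (n + n0)) (Some a) (Some a) / tr (real n0) (Some a) (Some b)) \<longlonglongrightarrow> 0"
      using LIMSEQ_ignore_initial_segment[OF tr_diag_tendsto_0[of a], of n0] n0
      by (auto intro!: tendsto_eq_intros)
  qed (auto simp: tr_nonneg)
  moreover have "f b = a" "b \<in> C" using cyc inC' by (auto simp: b_def)
  ultimately show False using f(2)[of b] by simp
qed

lemma tr_None_mono:
  assumes "0 \<le> s" "s \<le> t"
  shows "tr s i None \<le> tr t i None"
  using tr_add_ge[of s "t - s" i None None] assms by (simp add: tr_None)

text \<open>After a common time \<open>N\<close> each state has been absorbed with probability at least \<open>1 - \<theta> > 0\<close>, so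
  survival over blocks of length \<open>N\<close> decays geometrically.\<close>

lemma absorption_tendsto_1: "(\<lambda>n. tr (real n) i None) \<longlonglongrightarrow> 1"
proof -
  obtain n where n: "\<And>i. 0 < tr (real (n i)) (Some i) None"
    using absorption_possible by metis
  define N where "N = Max (range n)"
  define \<theta> where "\<theta> = Max (range (\<lambda>i. 1 - tr (real N) (Some i) None))"
  have \<theta>: "1 - tr (real N) (Some i) None \<le> \<theta>" for i
    unfolding \<theta>_def by (intro Max_ge) auto
  have "n i \<le> N" for i unfolding N_def by (intro Max_ge) auto
  then have "0 < tr (real N) (Some i) None" for i
    by (intro less_le_trans[OF n tr_None_mono]) auto
  then have \<theta>1: "\<theta> < 1"
    unfolding \<theta>_def by (subst Max_less_iff) auto
  have \<theta>0: "0 \<le> \<theta>"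
    using \<theta>[of undefined] tr_le_1[of "real N" "Some undefined" None] by simp
  have le: "1 - tr (real (k * N)) (Some i) None \<le> \<theta> ^ k" for k i
  proof (induction k arbitrary: i)
    case 0
    then show ?case by (simp add: tr_0)
  next
    case (Suc k)
    have "1 - tr (real (Suc k * N)) (Some i) None = (\<Sum>j\<in>UNIV. tr (real N + real (k * N)) (Some i) (Some j))"
      by (subst tr_sum_Some) (auto simp: algebra_simps)
    also have "\<dots> = (\<Sum>l\<in>UNIV. \<Sum>j\<in>UNIV. tr (real N) (Some i) l * tr (real (k * N)) l (Some j))"
      by (subst tr_add) (auto intro: sum.swap)
    also have "\<dots> = (\<Sum>l\<in>UNIV. tr (real N) (Some i) l * (1 - tr (real (k * N)) l None))"
      by (subst tr_sum_Some[symmetric]) (auto simp: sum_distrib_left)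
    also have "\<dots> = (\<Sum>l\<in>UNIV. tr (real N) (Some i) (Some l) * (1 - tr (real (k * N)) (Some l) None))"
      by (simp add: UNIV_option_conv sum.reindex tr_None)
    also have "\<dots> \<le> (\<Sum>l\<in>UNIV. tr (real N) (Some i) (Some l) * \<theta> ^ k)"
      by (intro sum_mono mult_left_mono Suc) (auto simp: tr_nonneg)
    also have "\<dots> = (1 - tr (real N) (Some i) None) * \<theta> ^ k"
      by (simp add: tr_sum_Some flip: sum_distrib_right)
    also have "\<dots> \<le> \<theta> * \<theta> ^ k"
      using \<theta>0 by (intro mult_right_mono \<theta>) auto
    finally show ?case by simp
  qed
  show ?thesis
  proof (cases i)
    case (Some a)
    have Npos: "N > 0"
    proof (rule ccontr)
      assume "\<not> N > 0"
      then show False using \<open>0 < tr (real N) (Some a) None\<close> by (simp add: tr_0)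
    qed
    show ?thesis
    proof (rule LIMSEQ_I)
      fix r :: real assume r: "0 < r"
      obtain k where k: "\<theta> ^ k < r"
        using real_arch_pow_inv[OF r \<theta>1] by blast
      have "norm (tr (real m) i None - 1) < r" if m: "k * N \<le> m" for m
      proof -
        have "tr (real (k * N)) i None \<le> tr (real m) i None"
          using m by (intro tr_None_mono) (auto simp flip: of_nat_mult)
        then show ?thesis
          using le[of k a] k tr_le_1[of "real m" i None] Some by (simp add: abs_if)
      qed
      then show "\<exists>no. \<forall>n\<ge>no. norm (tr (real n) i None - 1) < r" by blast
    qed
  qed (simp add: tr_None)
qed

end

section \<open>Path properties of the absorption time\<close>

definition right_constant :: "(real \<Rightarrow> 's) \<Rightarrow> bool" where
  "right_constant w \<longleftrightarrow> (\<forall>t\<ge>0. \<exists>\<delta>>0. \<forall>s. t \<le> s \<and> s < t + \<delta> \<longrightarrow> w s = w t)"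

definition absorbed_path :: "(real \<Rightarrow> 's option) \<Rightarrow> bool" where
  "absorbed_path w \<longleftrightarrow> (\<forall>t u. 0 \<le> t \<and> t \<le> u \<and> w t = None \<longrightarrow> w u = None) \<and> (\<exists>t\<ge>0. w t = None)"

text \<open>The inequality is strict because, by right continuity, a path not absorbed at \<open>u\<close> stays so for
  a moment longer.\<close>

lemma less_absorption_time_iff:
  assumes r: "right_constant w" and a: "absorbed_path w" and u: "0 \<le> u"
  shows "u < absorption_time w \<longleftrightarrow> w u \<noteq> None"
proof
  let ?Z = "{t. 0 \<le> t \<and> w t = None}"
  have bdd: "bdd_below ?Z" by (rule bdd_belowI[of _ 0]) auto
  show "w u \<noteq> None" if "u < absorption_time w"
  proof
    assume "w u = None"
    then have "absorption_time w \<le> u"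
      unfolding absorption_time_def using u by (intro cInf_lower bdd) auto
    then show False using that by simp
  qed
  show "u < absorption_time w" if n: "w u \<noteq> None"
  proof -
    obtain \<delta> where \<delta>: "\<delta> > 0" "\<And>s. u \<le> s \<Longrightarrow> s < u + \<delta> \<Longrightarrow> w s = w u"
      using r u unfolding right_constant_def by blast
    have "?Z \<noteq> {}" using a by (auto simp: absorbed_path_def)
    moreover have "u + \<delta> \<le> t" if t: "t \<in> ?Z" for t
    proof (rule ccontr)
      assume "\<not> u + \<delta> \<le> t"
      moreover have "\<not> t \<le> u"
      proof
        assume "t \<le> u"
        moreover have "0 \<le> t" "w t = None" using t by simp_all
        ultimately have "w u = None"
          using conjunct1[OF a[unfolded absorbed_path_def], THEN spec[of _ t], THEN spec[of _ u]]
          by blast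
        then show False using n by simp
      qed
      ultimately have "w t = w u" using \<delta>(2)[of t] by simp
      then show False using n t by simp
    qed
    ultimately have "u + \<delta> \<le> absorption_time w"
      unfolding absorption_time_def by (intro cInf_greatest) auto
    then show ?thesis using \<delta>(1) by simp
  qed
qed

lemma exists_rat_right:
  assumes "right_constant w" "0 \<le> t" "t < u"
  shows "\<exists>q::rat. t < of_rat q \<and> of_rat q < u \<and> w (of_rat q) = w t"
proof -
  obtain \<delta> where \<delta>: "\<delta> > 0" "\<And>s. t \<le> s \<Longrightarrow> s < t + \<delta> \<Longrightarrow> w s = w t"
    using assms unfolding right_constant_def by blast
  obtain q where "t < of_rat q" "of_rat q < min u (t + \<delta>)"
    using of_rat_dense[of t "min u (t + \<delta>)"] \<delta> assms by auto
  moreover from this have "w (of_rat q) = w t"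
    by (intro \<delta>(2)) simp_all
  ultimately show ?thesis by (intro exI[of _ q]) simp
qed

text \<open>Right continuity makes the absorption time exactly measurable: the rational times decide
  whether it lies below \<open>u\<close>. Paths that are never absorbed share the value \<open>Inf {}\<close>.\<close>

lemma measurable_absorption_time:
  assumes J: "\<And>t. 0 \<le> t \<Longrightarrow> J t \<in> measurable M (count_space UNIV)"
    and r: "\<And>\<omega>. \<omega> \<in> space M \<Longrightarrow> right_constant (\<lambda>t. J t \<omega>)"
  shows "(\<lambda>\<omega>. absorption_time (\<lambda>t. J t \<omega>)) \<in> borel_measurable M"
proof (rule borel_measurableI_less)
  fix u :: real
  let ?N = "\<lambda>q::rat. {\<omega>\<in>space M. J (of_rat q) \<omega> = None}"
  have N: "?N q \<in> sets M" if "0 \<le> q" for q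
    using J[of "of_rat q"] that by simp
  let ?Z = "\<lambda>\<omega>. {t. 0 \<le> t \<and> J t \<omega> = None}"
  have hit: "?Z \<omega> \<noteq> {} \<longleftrightarrow> (\<exists>q::rat. 0 \<le> q \<and> J (of_rat q) \<omega> = None)" if \<omega>: "\<omega> \<in> space M" for \<omega>
  proof
    assume "?Z \<omega> \<noteq> {}"
    then obtain t where t: "0 \<le> t" "J t \<omega> = None" by blast
    then obtain q :: rat where q: "t < of_rat q" "J (of_rat q) \<omega> = None"
      using exists_rat_right[OF r[OF \<omega>] t(1), of "t + 1"] by auto
    then have "0 \<le> q"
      using t(1) zero_le_of_rat_iff[of q, where 'a=real] by linarith
    then show "\<exists>q::rat. 0 \<le> q \<and> J (of_rat q) \<omega> = None"
      using q by blast
  next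
    assume "\<exists>q::rat. 0 \<le> q \<and> J (of_rat q) \<omega> = None"
    then obtain q :: rat where "0 \<le> q" "J (of_rat q) \<omega> = None" by blast
    then have "(of_rat q :: real) \<in> ?Z \<omega>" by simp
    then show "?Z \<omega> \<noteq> {}" by blast
  qed
  have less: "Inf (?Z \<omega>) < u \<longleftrightarrow> (\<exists>q::rat. 0 \<le> q \<and> of_rat q < u \<and> J (of_rat q) \<omega> = None)"
    if \<omega>: "\<omega> \<in> space M" and ne: "?Z \<omega> \<noteq> {}" for \<omega>
  proof -
    have bdd: "bdd_below (?Z \<omega>)" by (rule bdd_belowI[of _ 0]) auto
    have "Inf (?Z \<omega>) < u \<longleftrightarrow> (\<exists>t\<in>?Z \<omega>. t < u)"
      using cInf_less_iff[OF ne bdd] by blast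
    also have "\<dots> \<longleftrightarrow> (\<exists>q::rat. 0 \<le> q \<and> of_rat q < u \<and> J (of_rat q) \<omega> = None)"
    proof
      assume "\<exists>t\<in>?Z \<omega>. t < u"
      then obtain t where t: "0 \<le> t" "J t \<omega> = None" "t < u" by blast
      then obtain q :: rat where q: "t < of_rat q" "of_rat q < u" "J (of_rat q) \<omega> = None"
        using exists_rat_right[OF r[OF \<omega>] t(1), of u] by auto
      then have "0 \<le> q"
        using t(1) zero_le_of_rat_iff[of q, where 'a=real] by linarith
      then show "\<exists>q::rat. 0 \<le> q \<and> of_rat q < u \<and> J (of_rat q) \<omega> = None"
        using q by blast
    next
      assume "\<exists>q::rat. 0 \<le> q \<and> of_rat q < u \<and> J (of_rat q) \<omega> = None"
      then obtain q :: rat where "0 \<le> q" "of_rat q < u" "J (of_rat q) \<omega> = None" by blast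
      then show "\<exists>t\<in>?Z \<omega>. t < u"
        by (intro bexI[of _ "of_rat q"]) auto
    qed
    finally show ?thesis .
  qed
  have "{\<omega>\<in>space M. absorption_time (\<lambda>t. J t \<omega>) < u} =
      (\<Union>q\<in>{q. 0 \<le> q \<and> of_rat q < u}. ?N q) \<union>
      (if Inf {} < u then space M - (\<Union>q\<in>{q. 0 \<le> q}. ?N q) else {})" (is "?L = ?R")
  proof (intro set_eqI)
    fix \<omega>
    show "\<omega> \<in> ?L \<longleftrightarrow> \<omega> \<in> ?R"
    proof (cases "\<omega> \<in> space M \<and> ?Z \<omega> = {}")
      case True
      then have "absorption_time (\<lambda>t. J t \<omega>) = Inf {}"
        unfolding absorption_time_def by (simp only:)
      then show ?thesis using True hit[of \<omega>] by auto
    next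
      case False
      show ?thesis
      proof (cases "\<omega> \<in> space M")
        case in_space: True
        then have ne: "?Z \<omega> \<noteq> {}" using False by blast
        then have "\<exists>q\<in>{q. 0 \<le> q}. \<omega> \<in> ?N q"
          using hit[OF in_space] in_space by simp
        then show ?thesis
          using less[OF in_space ne] in_space unfolding absorption_time_def by auto
      qed auto
    qed
  qed
  also have "\<dots> \<in> sets M"
    using N by (intro sets.Un sets.countable_UN') (auto intro!: sets.Diff sets.countable_UN')
  finally show "{\<omega>\<in>space M. absorption_time (\<lambda>t. J t \<omega>) < u} \<in> sets M" .
qed

lemma markov_chain_right_constant:
  "markov_chain M G p J \<Longrightarrow> \<omega> \<in> space M \<Longrightarrow> right_constant (\<lambda>t. J t \<omega>)"
  by (simp add: markov_chain_def right_constant_def)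

lemma hat_vector_axis: "hat_vector (axis i 1) = axis (Some i) 1"
  by (simp add: hat_vector_def axis_def vec_eq_iff split: option.splits)

context phase_type_kernel
begin

text \<open>A return from the absorbing state between two rational times is a null event; right continuity
  carries this over to all times.\<close>

lemma AE_absorbed_path:
  assumes mc: "markov_chain M (hat_matrix Q) p J"
  shows "AE \<omega> in M. absorbed_path (\<lambda>t. J t \<omega>)"
proof -
  interpret prob_space M using mc by (simp add: markov_chain_def)
  have J [measurable]: "J t \<in> measurable M (count_space UNIV)" if "0 \<le> t" for t
    using mc that by (simp add: markov_chain_def)
  have "AE \<omega> in M. \<forall>q r::rat. 0 \<le> q \<and> q \<le> r \<and> J (of_rat q) \<omega> = None \<longrightarrow> J (of_rat r) \<omega> = None"
    unfolding AE_all_countable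
  proof (intro allI)
    fix q r :: rat
    show "AE \<omega> in M. 0 \<le> q \<and> q \<le> r \<and> J (of_rat q) \<omega> = None \<longrightarrow> J (of_rat r) \<omega> = None"
    proof (cases "0 \<le> q \<and> q \<le> r")
      case True
      then have qr: "0 \<le> (of_rat q::real)" "(of_rat q::real) \<le> of_rat r"
        by (auto simp: of_rat_less_eq)
      have "AE \<omega> in M. \<forall>j. \<not> (J (of_rat q) \<omega> = None \<and> J (of_rat r) \<omega> = Some j)"
        unfolding AE_all_countable
      proof
        fix j
        let ?E = "{\<omega>\<in>space M. J (of_rat q) \<omega> = None \<and> J (of_rat r) \<omega> = Some j}"
        have E: "?E \<in> sets M"
          using J[OF qr(1)] J[OF order_trans[OF qr]] by simp
        have "measure M ?E = 0"
          using markov_chain_two_times[OF mc qr, of None "Some j"] tr_None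
          by (simp add: tr_def)
        then have "?E \<in> null_sets M"
          using E by (auto simp: null_sets_def emeasure_eq_measure)
        then show "AE \<omega> in M. \<not> (J (of_rat q) \<omega> = None \<and> J (of_rat r) \<omega> = Some j)"
          by (rule AE_I') auto
      qed
      then show ?thesis
        by eventually_elim (metis not_None_eq)
    qed auto
  qed
  moreover have "AE \<omega> in M. \<exists>n::nat. J (real n) \<omega> = None"
  proof -
    let ?E = "{\<omega>\<in>space M. \<forall>n::nat. J (real n) \<omega> \<noteq> None}"
    have "?E = (\<Inter>n. {\<omega>\<in>space M. J (real n) \<omega> \<noteq> None})" by auto
    also have "\<dots> \<in> sets M"
      using J by (intro sets.countable_INT) auto
    finally have E: "?E \<in> sets M" .
    have le: "measure M ?E \<le> 1 - law_at (hat_matrix Q) p (real n) None" for n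
    proof -
      have s: "{\<omega>\<in>space M. J (real n) \<omega> = None} \<in> sets M"
        using J[of "real n"] by simp
      have "?E \<subseteq> space M - {\<omega>\<in>space M. J (real n) \<omega> = None}"
        by blast
      then have "measure M ?E \<le> measure M (space M - {\<omega>\<in>space M. J (real n) \<omega> = None})"
        using s by (intro finite_measure_mono) auto
      also have "\<dots> = 1 - law_at (hat_matrix Q) p (real n) None"
        using s markov_chain_one_time[OF mc, of "real n" None] by (simp add: prob_compl)
      finally show ?thesis .
    qed
    have "(\<lambda>n. 1 - law_at (hat_matrix Q) p (real n) None) \<longlonglongrightarrow> 1 - (\<Sum>a\<in>UNIV. p $ a * 1)"
      unfolding law_at_def tr_def[symmetric]
      by (intro tendsto_intros absorption_tendsto_1)
    moreover have "(\<Sum>a\<in>UNIV. p $ a * 1) = 1"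
      using markov_chain_law_sum[OF mc order_refl]
      by (simp add: law_at_def matrix_exp_0 if_distrib[of "\<lambda>x. _ * x"] cong: if_cong)
    ultimately have "(\<lambda>n. 1 - law_at (hat_matrix Q) p (real n) None) \<longlonglongrightarrow> 0" by simp
    then have "measure M ?E \<le> 0"
      using le by (intro LIMSEQ_le_const) auto
    then have "?E \<in> null_sets M"
      using E by (auto simp: null_sets_def emeasure_eq_measure measure_le_0_iff)
    then show ?thesis by (rule AE_I') auto
  qed
  ultimately show ?thesis
    using AE_space
  proof eventually_elim
    case (elim \<omega>)
    have r: "right_constant (\<lambda>t. J t \<omega>)"
      using markov_chain_right_constant[OF mc] elim by blast
    show ?case
      unfolding absorbed_path_def
    proof (intro conjI allI impI)
      fix t u assume *: "0 \<le> t \<and> t \<le> u \<and> J t \<omega> = None"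
      show "J u \<omega> = None"
      proof (cases "t = u")
        case False
        then obtain q :: rat where q: "t < of_rat q" "of_rat q < u" "J (of_rat q) \<omega> = None"
          using exists_rat_right[OF r, of t u] * by auto
        obtain s :: rat where s: "u < of_rat s" "J (of_rat s) \<omega> = J u \<omega>"
          using exists_rat_right[OF r, of u "u + 1"] * by auto
        have "0 \<le> q"
          using q * zero_le_of_rat_iff[of q, where 'a=real] by linarith
        moreover have "q \<le> s"
          using q s of_rat_less_eq[of q s, where 'a=real] by linarith
        ultimately show ?thesis using elim(1) q s by metis
      qed (use * in auto)
    next
      show "\<exists>t\<ge>0. J t \<omega> = None"
        using elim(2) by (metis of_nat_0_le_iff)
    qed
  qed
qed

lemma law_at_nonneg:
  assumes "markov_chain M (hat_matrix Q) p J" "0 \<le> t"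
  shows "0 \<le> law_at (hat_matrix Q) p t j"
  using markov_chain_one_time[OF assms, of j, symmetric] by simp

lemma law_at_le_1:
  assumes mc: "markov_chain M (hat_matrix Q) p J" and t: "0 \<le> t"
  shows "law_at (hat_matrix Q) p t j \<le> 1"
proof -
  interpret prob_space M using mc by (simp add: markov_chain_def)
  show ?thesis using markov_chain_one_time[OF mc t, of j, symmetric] by simp
qed

lemma emeasure_survival:
  assumes mc: "markov_chain M (hat_matrix Q) (axis (Some i) 1) J" and s: "0 \<le> s"
  shows "emeasure M {\<omega>\<in>space M. s < absorption_time (\<lambda>t. J t \<omega>)} = ennreal (1 - tr s (Some i) None)"
proof -
  interpret prob_space M using mc by (simp add: markov_chain_def)
  have J: "J t \<in> measurable M (count_space UNIV)" if "0 \<le> t" for t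
    using mc that by (simp add: markov_chain_def)
  have S: "(\<lambda>\<omega>. absorption_time (\<lambda>t. J t \<omega>)) \<in> borel_measurable M"
    using measurable_absorption_time[OF J markov_chain_right_constant[OF mc]] .
  have N: "{\<omega>\<in>space M. J s \<omega> = None} \<in> sets M"
    using J[OF s] by simp
  have "emeasure M {\<omega>\<in>space M. s < absorption_time (\<lambda>t. J t \<omega>)} = emeasure M (space M - {\<omega>\<in>space M. J s \<omega> = None})"
  proof (rule emeasure_eq_AE)
    show "AE \<omega> in M. \<omega> \<in> {\<omega>\<in>space M. s < absorption_time (\<lambda>t. J t \<omega>)} \<longleftrightarrow>
        \<omega> \<in> space M - {\<omega>\<in>space M. J s \<omega> = None}"
      using AE_absorbed_path[OF mc] AE_space
      by eventually_elim (auto simp: less_absorption_time_iff[OF markov_chain_right_constant[OF mc] _ s])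
  qed (use N S in auto)
  also have "\<dots> = ennreal (1 - tr s (Some i) None)"
    using N markov_chain_one_time[OF mc s, of None]
    by (simp add: emeasure_eq_measure prob_compl law_at_axis tr_def)
  finally show ?thesis .
qed

text \<open>The law is encoded by its tail, which determines it and is the probability
  of not being absorbed yet.\<close>

definition phase_law :: "'m \<Rightarrow> real measure \<Rightarrow> bool" where
  "phase_law i \<mu> \<longleftrightarrow> sets \<mu> = sets borel \<and>
     (\<forall>s. emeasure \<mu> {s<..} = (if s < 0 then 1 else ennreal (1 - tr s (Some i) None)))"

lemma phase_law_phase_type:
  assumes "phase_type_distribution Q (axis i 1) \<mu>"
  shows "phase_law i \<mu>"
proof -
  obtain P :: "(real \<Rightarrow> 'm option) measure"
    where P: "markov_chain P (hat_matrix Q) (axis (Some i) 1) (\<lambda>t \<omega>. \<omega> t)"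
      and \<mu>: "\<mu> = distr P borel absorption_time"
    using assms unfolding phase_type_distribution_def hat_vector_axis by blast
  interpret prob_space P using P by (simp add: markov_chain_def)
  have coord: "(\<lambda>\<omega>. \<omega> t) \<in> measurable P (count_space UNIV)" if "0 \<le> t" for t
    using P that by (simp add: markov_chain_def)
  have S: "absorption_time \<in> borel_measurable P"
    using measurable_absorption_time[OF coord markov_chain_right_constant[OF P]] by simp
  have em: "emeasure \<mu> {s<..} = emeasure P {\<omega>\<in>space P. s < absorption_time \<omega>}" for s
    unfolding \<mu> using S by (subst emeasure_distr) (auto intro!: arg_cong[where f="emeasure P"])
  have "emeasure P {\<omega>\<in>space P. s < absorption_time \<omega>} = 1" if s: "s < 0" for s
  proof -
    have "emeasure P {\<omega>\<in>space P. s < absorption_time \<omega>} = emeasure P (space P)"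
    proof (rule emeasure_eq_AE)
      show "AE \<omega> in P. \<omega> \<in> {\<omega>\<in>space P. s < absorption_time \<omega>} \<longleftrightarrow> \<omega> \<in> space P"
        using AE_absorbed_path[OF P] AE_space
      proof eventually_elim
        case (elim \<omega>)
        then have "0 \<le> absorption_time \<omega>"
          unfolding absorption_time_def by (intro cInf_greatest) (auto simp: absorbed_path_def)
        then show ?case using s elim by simp
      qed
    qed (use S in auto)
    then show ?thesis by (simp add: emeasure_space_1)
  qed
  then show ?thesis
    using emeasure_survival[OF P] unfolding phase_law_def em by (auto simp: \<mu>)
qed

end

section \<open>Restarting the chain at an independent random time\<close>

text \<open>The \<open>\<sigma>\<close>-algebra \<open>H\<close> holds the information about the past. Independence is only required of the
  joint laws at two times, since the law of the residual time is determined by the events that the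
  chain is in \<open>i\<close> at one time and still alive at a later one.\<close>

locale independent_time = phase_type_kernel Q
  for Q :: "real^'m^'m" +
  fixes M :: "'a measure" and p :: "real^('m option)" and J :: "real \<Rightarrow> 'a \<Rightarrow> 'm option"
    and H :: "'a measure" and d :: "'a \<Rightarrow> real"
  assumes chain: "markov_chain M (hat_matrix Q) p J"
    and space_H: "space H = space M"
    and sets_H: "sets H \<subseteq> sets M"
    and indep: "\<And>A t u i j. A \<in> sets H \<Longrightarrow> 0 \<le> t \<Longrightarrow> t \<le> u \<Longrightarrow>
      measure M (A \<inter> {\<omega>\<in>space M. J t \<omega> = i \<and> J u \<omega> = j}) =
      measure M A * measure M {\<omega>\<in>space M. J t \<omega> = i \<and> J u \<omega> = j}"
    and d_measurable: "d \<in> borel_measurable H"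
    and d_nonneg: "\<And>\<omega>. \<omega> \<in> space M \<Longrightarrow> 0 \<le> d \<omega>"
begin

sublocale prob_space M
  using chain by (simp add: markov_chain_def)

abbreviation \<pi> :: "real \<Rightarrow> 'm option \<Rightarrow> real" where
  "\<pi> \<equiv> law_at (hat_matrix Q) p"

abbreviation S :: "'a \<Rightarrow> real" where
  "S \<omega> \<equiv> absorption_time (\<lambda>t. J t \<omega>)"

lemma J_measurable: "0 \<le> t \<Longrightarrow> J t \<in> measurable M (count_space UNIV)"
  using chain by (simp add: markov_chain_def)

lemma S_measurable: "S \<in> borel_measurable M"
  using measurable_absorption_time[OF J_measurable markov_chain_right_constant[OF chain]] .

lemma H_imp_M: "A \<in> sets H \<Longrightarrow> A \<in> sets M"
  using sets_H by blast

lemma measurable_H_imp_M: "f \<in> borel_measurable H \<Longrightarrow> f \<in> borel_measurable M"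
  using space_H sets_H by (auto simp: measurable_def)

text \<open>Rounding up to the grid of mesh \<open>1 / (k + 1)\<close>, strictly, approaches the time from the
  right, as right continuity of the paths demands, and keeps it a function of the time alone.\<close>

definition cell :: "nat \<Rightarrow> 'a \<Rightarrow> nat" where
  "cell k \<omega> = nat \<lfloor>real (Suc k) * d \<omega>\<rfloor>"

definition grid :: "nat \<Rightarrow> nat \<Rightarrow> real" where
  "grid k n = (real n + 1) / real (Suc k)"

lemma grid_nonneg: "0 \<le> grid k n"
  by (simp add: grid_def)

lemma grid_cell_bounds:
  assumes "\<omega> \<in> space M"
  shows "d \<omega> < grid k (cell k \<omega>)" "grid k (cell k \<omega>) \<le> d \<omega> + 1 / real (Suc k)"
proof -
  have "0 \<le> real (Suc k) * d \<omega>" using d_nonneg[OF assms] by simp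
  then have c: "real (cell k \<omega>) = real_of_int \<lfloor>real (Suc k) * d \<omega>\<rfloor>"
    unfolding cell_def by (simp del: of_nat_Suc)
  have "real (Suc k) * d \<omega> < real (cell k \<omega>) + 1" "real (cell k \<omega>) \<le> real (Suc k) * d \<omega>"
    unfolding c by linarith+
  then show "d \<omega> < grid k (cell k \<omega>)" "grid k (cell k \<omega>) \<le> d \<omega> + 1 / real (Suc k)"
    unfolding grid_def by (simp_all add: field_simps del: of_nat_Suc)
qed

lemma grid_cell_tendsto:
  assumes "\<omega> \<in> space M"
  shows "(\<lambda>k. grid k (cell k \<omega>)) \<longlonglongrightarrow> d \<omega>"
proof (rule tendsto_sandwich[where f="\<lambda>_. d \<omega>" and h="\<lambda>k. d \<omega> + 1 / real (Suc k)"])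
  show "(\<lambda>k. d \<omega> + 1 / real (Suc k)) \<longlonglongrightarrow> d \<omega>"
    using tendsto_add[OF tendsto_const LIMSEQ_inverse_real_of_nat, of "d \<omega>"]
    by (simp add: inverse_eq_divide)
  show "\<forall>\<^sub>F k in sequentially. d \<omega> \<le> grid k (cell k \<omega>)"
    using grid_cell_bounds(1)[OF assms] by (intro always_eventually allI less_imp_le)
qed (use grid_cell_bounds(2)[OF assms] in auto)

lemma cell_sets: "{\<omega>\<in>space M. cell k \<omega> = n} \<in> sets H"
proof -
  have "cell k \<in> measurable H (count_space UNIV)"
    unfolding cell_def using d_measurable by measurable
  then have "{\<omega>\<in>space H. cell k \<omega> = n} \<in> sets H"
    by simp
  then show ?thesis by (simp add: space_H)
qed

lemma J_grid_tendsto: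
  assumes "\<omega> \<in> space M" "0 \<le> s"
  shows "\<forall>\<^sub>F k in sequentially. J (grid k (cell k \<omega>) + s) \<omega> = J (d \<omega> + s) \<omega>"
proof -
  obtain \<delta> where \<delta>: "\<delta> > 0"
      "\<And>t. d \<omega> + s \<le> t \<Longrightarrow> t < d \<omega> + s + \<delta> \<Longrightarrow> J t \<omega> = J (d \<omega> + s) \<omega>"
    using markov_chain_right_constant[OF chain assms(1)] d_nonneg[OF assms(1)] assms(2)
    unfolding right_constant_def by (metis add_nonneg_nonneg)
  have "\<forall>\<^sub>F k in sequentially. grid k (cell k \<omega>) < d \<omega> + \<delta>"
    using order_tendstoD(2)[OF grid_cell_tendsto[OF assms(1)], of "d \<omega> + \<delta>"] \<delta>(1) by simp
  then show ?thesis
  proof eventually_elim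
    case (elim k)
    show ?case
      using grid_cell_bounds(1)[OF assms(1), of k] elim by (intro \<delta>(2)) auto
  qed
qed

lemma J_grid_sets: 
  assumes "0 \<le> s"
  shows "{\<omega>\<in>space M. J (grid k (cell k \<omega>) + s) \<omega> = j} \<in> sets M"
proof -
  have "{\<omega>\<in>space M. J (grid k (cell k \<omega>) + s) \<omega> = j} =
      (\<Union>n. {\<omega>\<in>space M. cell k \<omega> = n} \<inter> {\<omega>\<in>space M. J (grid k n + s) \<omega> = j})"
    by auto
  moreover have "{\<omega>\<in>space M. J (grid k n + s) \<omega> = j} \<in> sets M" for n
    using J_measurable[OF add_nonneg_nonneg[OF grid_nonneg[of k n] assms]] by simp
  then have "(\<Union>n. {\<omega>\<in>space M. cell k \<omega> = n} \<inter> {\<omega>\<in>space M. J (grid k n + s) \<omega> = j}) \<in> sets M"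
    using H_imp_M[OF cell_sets[of k]] by (intro sets.countable_UN) auto
  ultimately show ?thesis by simp
qed

lemma J_random_sets:
  assumes s: "0 \<le> s"
  shows "{\<omega>\<in>space M. J (d \<omega> + s) \<omega> = j} \<in> sets M"
proof -
  have "{\<omega>\<in>space M. J (d \<omega> + s) \<omega> = j} =
      {\<omega>\<in>space M. \<exists>N. \<forall>k\<ge>N. J (grid k (cell k \<omega>) + s) \<omega> = j}"
  proof (intro Collect_cong conj_cong refl)
    fix \<omega> assume \<omega>: "\<omega> \<in> space M"
    obtain N where N: "\<And>k. k \<ge> N \<Longrightarrow> J (grid k (cell k \<omega>) + s) \<omega> = J (d \<omega> + s) \<omega>"
      using J_grid_tendsto[OF \<omega> s] unfolding eventually_sequentially by blast
    show "(J (d \<omega> + s) \<omega> = j) \<longleftrightarrow> (\<exists>N. \<forall>k\<ge>N. J (grid k (cell k \<omega>) + s) \<omega> = j)"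
    proof
      assume "\<exists>N. \<forall>k\<ge>N. J (grid k (cell k \<omega>) + s) \<omega> = j"
      then obtain N' where "\<And>k. k \<ge> N' \<Longrightarrow> J (grid k (cell k \<omega>) + s) \<omega> = j" by blast
      from this[of "max N N'"] N[of "max N N'"] show "J (d \<omega> + s) \<omega> = j" by simp
    qed (use N in blast)
  qed
  also have "\<dots> = (\<Union>N. \<Inter>k\<in>{N..}. {\<omega>\<in>space M. J (grid k (cell k \<omega>) + s) \<omega> = j})"
    by auto
  also have "\<dots> \<in> sets M"
    using J_grid_sets[OF s] by (intro sets.countable_UN' sets.countable_INT') auto
  finally show ?thesis .
qed

lemma two_times_grid:
  assumes A: "A \<in> sets H" and s: "0 \<le> s"
  shows "emeasure M (A \<inter> {\<omega>\<in>space M. J (grid k (cell k \<omega>)) \<omega> = i \<and> J (grid k (cell k \<omega>) + s) \<omega> = j}) =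
    (\<integral>\<^sup>+\<omega>. indicator A \<omega> * ennreal (\<pi> (grid k (cell k \<omega>)) i * tr s i j) \<partial>M)"
proof -
  define C where "C n = A \<inter> {\<omega>\<in>space M. cell k \<omega> = n}" for n
  define D where "D n = {\<omega>\<in>space M. J (grid k n) \<omega> = i \<and> J (grid k n + s) \<omega> = j}" for n
  have C: "C n \<in> sets H" for n
    unfolding C_def using A cell_sets by auto
  have CM: "C n \<in> sets M" for n
    by (rule H_imp_M[OF C])
  have D: "D n \<in> sets M" for n
    unfolding D_def using J_measurable[OF grid_nonneg] J_measurable[OF add_nonneg_nonneg[OF grid_nonneg s]]
    by simp
  have "A \<inter> {\<omega>\<in>space M. J (grid k (cell k \<omega>)) \<omega> = i \<and> J (grid k (cell k \<omega>) + s) \<omega> = j} = (\<Union>n. C n \<inter> D n)"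
    by (auto simp: C_def D_def)
  also have "emeasure M \<dots> = (\<Sum>n. emeasure M (C n \<inter> D n))"
    by (rule suminf_emeasure[symmetric])
      (use CM D in \<open>auto simp: disjoint_family_on_def C_def\<close>)
  also have "\<dots> = (\<Sum>n. ennreal (\<pi> (grid k n) i * tr s i j) * emeasure M (C n))"
  proof (intro suminf_cong)
    fix n
    have "measure M (C n \<inter> D n) = measure M (C n) * measure M (D n)"
      unfolding D_def using grid_nonneg s by (intro indep C) auto
    also have "measure M (D n) = \<pi> (grid k n) i * tr s i j"
      unfolding D_def tr_def using s
      by (subst markov_chain_two_times[OF chain grid_nonneg]) auto
    finally show "emeasure M (C n \<inter> D n) = ennreal (\<pi> (grid k n) i * tr s i j) * emeasure M (C n)"
      using law_at_nonneg[OF chain grid_nonneg] tr_nonneg[OF s]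
      by (simp add: emeasure_eq_measure ennreal_mult mult.commute)
  qed
  also have "\<dots> = (\<Sum>n. \<integral>\<^sup>+\<omega>. ennreal (\<pi> (grid k n) i * tr s i j) * indicator (C n) \<omega> \<partial>M)"
    by (intro suminf_cong) (simp add: nn_integral_cmult_indicator CM)
  also have "\<dots> = (\<integral>\<^sup>+\<omega>. (\<Sum>n. ennreal (\<pi> (grid k n) i * tr s i j) * indicator (C n) \<omega>) \<partial>M)"
    by (intro nn_integral_suminf[symmetric] borel_measurable_times_ennreal
        borel_measurable_const borel_measurable_indicator CM)
  also have "\<dots> = (\<integral>\<^sup>+\<omega>. indicator A \<omega> * ennreal (\<pi> (grid k (cell k \<omega>)) i * tr s i j) \<partial>M)"
  proof (intro nn_integral_cong)
    fix \<omega> assume \<omega>: "\<omega> \<in> space M"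
    have "(\<Sum>n. ennreal (\<pi> (grid k n) i * tr s i j) * indicator (C n) \<omega>) =
        (\<Sum>n\<in>{cell k \<omega>}. ennreal (\<pi> (grid k n) i * tr s i j) * indicator (C n) \<omega>)"
      by (intro suminf_finite) (auto simp: C_def indicator_def)
    then show "(\<Sum>n. ennreal (\<pi> (grid k n) i * tr s i j) * indicator (C n) \<omega>) =
        indicator A \<omega> * ennreal (\<pi> (grid k (cell k \<omega>)) i * tr s i j)"
      using \<omega> by (simp add: C_def indicator_def)
  qed
  finally show ?thesis .
qed

lemma law_measurable:
  assumes "f \<in> borel_measurable N"
  shows "(\<lambda>\<omega>. \<pi> (f \<omega>) i) \<in> borel_measurable N"
proof -
  have "(\<lambda>t. \<pi> t i) \<in> borel_measurable borel"
    by (intro borel_measurable_continuous_onI continuous_at_imp_continuous_on ballI isCont_law_at)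
  then show ?thesis using assms by (rule measurable_compose[rotated])
qed

lemma two_times_random:
  assumes A: "A \<in> sets H" and s: "0 \<le> s"
  shows "emeasure M (A \<inter> {\<omega>\<in>space M. J (d \<omega>) \<omega> = i \<and> J (d \<omega> + s) \<omega> = j}) =
    (\<integral>\<^sup>+\<omega>. indicator A \<omega> * ennreal (\<pi> (d \<omega>) i) \<partial>M) * ennreal (tr s i j)"
proof -
  note [measurable] = H_imp_M[OF A] measurable_H_imp_M[OF d_measurable]
  let ?E = "\<lambda>k. A \<inter> {\<omega>\<in>space M. J (grid k (cell k \<omega>)) \<omega> = i \<and> J (grid k (cell k \<omega>) + s) \<omega> = j}"
  let ?F = "A \<inter> {\<omega>\<in>space M. J (d \<omega>) \<omega> = i \<and> J (d \<omega> + s) \<omega> = j}"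
  have Em: "?E k \<in> sets M" for k
  proof -
    have "?E k = A \<inter> {\<omega>\<in>space M. J (grid k (cell k \<omega>) + 0) \<omega> = i} \<inter> {\<omega>\<in>space M. J (grid k (cell k \<omega>) + s) \<omega> = j}"
      by auto
    also have "\<dots> \<in> sets M"
      using J_grid_sets[OF order_refl] J_grid_sets[OF s] H_imp_M[OF A] by (intro sets.Int) auto
    finally show ?thesis .
  qed
  have Fm: "?F \<in> sets M"
  proof -
    have "?F = A \<inter> {\<omega>\<in>space M. J (d \<omega> + 0) \<omega> = i} \<inter> {\<omega>\<in>space M. J (d \<omega> + s) \<omega> = j}"
      by auto
    also have "\<dots> \<in> sets M"
      using J_random_sets[OF order_refl] J_random_sets[OF s] H_imp_M[OF A] by (intro sets.Int) auto
    finally show ?thesis .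
  qed
  have [measurable]: "(\<lambda>\<omega>. grid k (cell k \<omega>)) \<in> borel_measurable M" for k
    unfolding grid_def cell_def by measurable
  have [measurable]: "(\<lambda>\<omega>. \<pi> (d \<omega>) i) \<in> borel_measurable M"
    by (rule law_measurable) measurable
  have "(\<lambda>k. \<integral>\<^sup>+\<omega>. indicator (?E k) \<omega> \<partial>M) \<longlonglongrightarrow> (\<integral>\<^sup>+\<omega>. indicator ?F \<omega> \<partial>M)"
  proof (rule nn_integral_dominated_convergence[where w="\<lambda>_. 1"])
    show "AE \<omega> in M. (\<lambda>k. indicator (?E k) \<omega>) \<longlonglongrightarrow> (indicator ?F \<omega> :: ennreal)"
    proof (rule AE_I2)
      fix \<omega> assume \<omega>: "\<omega> \<in> space M"
      have "\<forall>\<^sub>F k in sequentially. indicator (?E k) \<omega> = (indicator ?F \<omega> :: ennreal)"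
        using J_grid_tendsto[OF \<omega> order_refl] J_grid_tendsto[OF \<omega> s]
        by eventually_elim (auto simp: indicator_def)
      then show "(\<lambda>k. indicator (?E k) \<omega>) \<longlonglongrightarrow> (indicator ?F \<omega> :: ennreal)"
        by (rule tendsto_eventually)
    qed
    show "(\<integral>\<^sup>+\<omega>. 1 \<partial>M) < \<infinity>" by (simp add: emeasure_space_1)
    show "AE \<omega> in M. indicator (?E k) \<omega> \<le> (1::ennreal)" for k
      by (intro AE_I2) (simp split: split_indicator)
    show "indicator (?E k) \<in> borel_measurable M" for k
      by (rule borel_measurable_indicator[OF Em])
    show "indicator ?F \<in> borel_measurable M"
      by (rule borel_measurable_indicator[OF Fm])
  qed simp
  then have L: "(\<lambda>k. emeasure M (?E k)) \<longlonglongrightarrow> emeasure M ?F"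
    using Em Fm by simp
  have "(\<lambda>k. \<integral>\<^sup>+\<omega>. indicator A \<omega> * ennreal (\<pi> (grid k (cell k \<omega>)) i * tr s i j) \<partial>M)
      \<longlonglongrightarrow> (\<integral>\<^sup>+\<omega>. indicator A \<omega> * ennreal (\<pi> (d \<omega>) i * tr s i j) \<partial>M)"
  proof (rule nn_integral_dominated_convergence[where w="\<lambda>_. 1"])
    have [measurable]: "(\<lambda>\<omega>. \<pi> (grid k (cell k \<omega>)) i) \<in> borel_measurable M" for k
      by (rule law_measurable) measurable
    show "(\<lambda>\<omega>. indicator A \<omega> * ennreal (\<pi> (grid k (cell k \<omega>)) i * tr s i j)) \<in> borel_measurable M" for k
      by measurable
    show "(\<lambda>\<omega>. indicator A \<omega> * ennreal (\<pi> (d \<omega>) i * tr s i j)) \<in> borel_measurable M"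
      by measurable
    show "AE \<omega> in M. indicator A \<omega> * ennreal (\<pi> (grid k (cell k \<omega>)) i * tr s i j) \<le> 1" for k
    proof (rule AE_I2)
      fix \<omega>
      have "\<pi> (grid k (cell k \<omega>)) i * tr s i j \<le> 1 * 1"
        by (intro mult_mono law_at_le_1[OF chain] tr_le_1 tr_nonneg grid_nonneg s) auto
      then show "indicator A \<omega> * ennreal (\<pi> (grid k (cell k \<omega>)) i * tr s i j) \<le> 1"
        by (simp add: indicator_def)
    qed
    show "AE \<omega> in M. (\<lambda>k. indicator A \<omega> * ennreal (\<pi> (grid k (cell k \<omega>)) i * tr s i j))
        \<longlonglongrightarrow> indicator A \<omega> * ennreal (\<pi> (d \<omega>) i * tr s i j)"
    proof (rule AE_I2)
      fix \<omega> assume \<omega>: "\<omega> \<in> space M"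
      have "(\<lambda>k. ennreal (\<pi> (grid k (cell k \<omega>)) i * tr s i j)) \<longlonglongrightarrow> ennreal (\<pi> (d \<omega>) i * tr s i j)"
        by (intro tendsto_ennrealI tendsto_mult_right isCont_tendsto_compose[OF isCont_law_at] grid_cell_tendsto \<omega>)
      then show "(\<lambda>k. indicator A \<omega> * ennreal (\<pi> (grid k (cell k \<omega>)) i * tr s i j))
        \<longlonglongrightarrow> indicator A \<omega> * ennreal (\<pi> (d \<omega>) i * tr s i j)"
        by (cases "\<omega> \<in> A") auto
    qed
    show "(\<integral>\<^sup>+\<omega>. 1 \<partial>M) < \<infinity>" by (simp add: emeasure_space_1)
  qed auto
  then have "emeasure M ?F = (\<integral>\<^sup>+\<omega>. indicator A \<omega> * ennreal (\<pi> (d \<omega>) i * tr s i j) \<partial>M)"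
    using LIMSEQ_unique[OF L[unfolded two_times_grid[OF A s]]] by simp
  also have "\<dots> = (\<integral>\<^sup>+\<omega>. indicator A \<omega> * ennreal (\<pi> (d \<omega>) i) * ennreal (tr s i j) \<partial>M)"
    using law_at_nonneg[OF chain d_nonneg] tr_nonneg[OF s]
    by (intro nn_integral_cong) (simp add: ennreal_mult mult.assoc)
  also have "\<dots> = (\<integral>\<^sup>+\<omega>. indicator A \<omega> * ennreal (\<pi> (d \<omega>) i) \<partial>M) * ennreal (tr s i j)"
    by (intro nn_integral_multc) measurable
  finally show ?thesis .
qed

lemma one_time_random:
  assumes "A \<in> sets H"
  shows "emeasure M (A \<inter> {\<omega>\<in>space M. J (d \<omega>) \<omega> = i}) = (\<integral>\<^sup>+\<omega>. indicator A \<omega> * ennreal (\<pi> (d \<omega>) i) \<partial>M)"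
  using two_times_random[OF assms order_refl, of i i] by (simp add: tr_0)

lemma one_time_random_sets:
  assumes "A \<in> sets H"
  shows "A \<inter> {\<omega>\<in>space M. J (d \<omega>) \<omega> = i} \<in> sets M"
  using J_random_sets[OF order_refl, of i] H_imp_M[OF assms] by auto

lemma AE_less_S_iff: "AE \<omega> in M. \<forall>s\<ge>0. d \<omega> + s < S \<omega> \<longleftrightarrow> J (d \<omega> + s) \<omega> \<noteq> None"
  using AE_absorbed_path[OF chain] AE_space
  by eventually_elim
    (use less_absorption_time_iff[OF markov_chain_right_constant[OF chain]] d_nonneg in auto)

lemma emeasure_residual:
  assumes A: "A \<in> sets H"
  shows "emeasure M (A \<inter> {\<omega>\<in>space M. J (d \<omega>) \<omega> = Some i \<and> s < S \<omega> - d \<omega>}) =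
    emeasure M (A \<inter> {\<omega>\<in>space M. J (d \<omega>) \<omega> = Some i}) * (if s < 0 then 1 else ennreal (1 - tr s (Some i) None))"
proof -
  note [measurable] = H_imp_M[OF A] measurable_H_imp_M[OF d_measurable] S_measurable
  let ?B = "A \<inter> {\<omega>\<in>space M. J (d \<omega>) \<omega> = Some i}"
  have B [measurable]: "?B \<in> sets M" by (rule one_time_random_sets[OF A])
  have eq: "A \<inter> {\<omega>\<in>space M. J (d \<omega>) \<omega> = Some i \<and> s < S \<omega> - d \<omega>} = ?B \<inter> {\<omega>\<in>space M. s < S \<omega> - d \<omega>}"
    by auto
  have meas: "?B \<inter> {\<omega>\<in>space M. s < S \<omega> - d \<omega>} \<in> sets M" by measurable
  show ?thesis
  proof (cases "s < 0")
    case True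
    have "emeasure M (?B \<inter> {\<omega>\<in>space M. s < S \<omega> - d \<omega>}) = emeasure M ?B"
    proof (rule emeasure_eq_AE)
      show "AE \<omega> in M. \<omega> \<in> ?B \<inter> {\<omega>\<in>space M. s < S \<omega> - d \<omega>} \<longleftrightarrow> \<omega> \<in> ?B"
        using AE_less_S_iff
      proof eventually_elim
        case (elim \<omega>)
        then have "d \<omega> < S \<omega> \<longleftrightarrow> J (d \<omega>) \<omega> \<noteq> None" by (metis add_0_right order_refl)
        then show ?case using True by auto
      qed
    qed (use meas B in auto)
    then show ?thesis using True unfolding eq by simp
  next
    case False
    then have s: "0 \<le> s" by simp
    let ?C = "\<lambda>j. A \<inter> {\<omega>\<in>space M. J (d \<omega>) \<omega> = Some i \<and> J (d \<omega> + s) \<omega> = Some j}"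
    have C: "?C j \<in> sets M" for j
    proof -
      have "?C j = ?B \<inter> {\<omega>\<in>space M. J (d \<omega> + s) \<omega> = Some j}" by auto
      then show ?thesis using J_random_sets[OF s] B by auto
    qed
    have "emeasure M (?B \<inter> {\<omega>\<in>space M. s < S \<omega> - d \<omega>}) = emeasure M (\<Union>j\<in>UNIV. ?C j)"
    proof (rule emeasure_eq_AE)
      show "AE \<omega> in M. \<omega> \<in> ?B \<inter> {\<omega>\<in>space M. s < S \<omega> - d \<omega>} \<longleftrightarrow> \<omega> \<in> (\<Union>j\<in>UNIV. ?C j)"
        using AE_less_S_iff
      proof eventually_elim
        case (elim \<omega>)
        then have "d \<omega> + s < S \<omega> \<longleftrightarrow> (\<exists>j. J (d \<omega> + s) \<omega> = Some j)" using s by auto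
        moreover have "s < S \<omega> - d \<omega> \<longleftrightarrow> d \<omega> + s < S \<omega>" by linarith
        ultimately show ?case by auto
      qed
      show "(\<Union>j\<in>UNIV. ?C j) \<in> sets M"
        using C by (intro sets.finite_UN) auto
    qed (rule meas)
    also have "\<dots> = (\<Sum>j\<in>UNIV. emeasure M (?C j))"
      using C by (intro sum_emeasure[symmetric]) (auto simp: disjoint_family_on_def)
    also have "\<dots> = (\<Sum>j\<in>UNIV. emeasure M ?B * ennreal (tr s (Some i) (Some j)))"
      by (simp only: two_times_random[OF A s] one_time_random[OF A])
    also have "\<dots> = emeasure M ?B * ennreal (1 - tr s (Some i) None)"
      using tr_nonneg[OF s] by (simp add: sum_ennreal tr_sum_Some[OF s] flip: sum_distrib_left)
    finally show ?thesis using False unfolding eq by simp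
  qed
qed

text \<open>The loss of memory: given the state \<open>i\<close> at the random time, the residual time to
  absorption has the phasetype law started from \<open>i\<close>, whatever happened in \<open>H\<close>.\<close>

lemma nn_integral_residual:
  assumes A: "A \<in> sets H" and \<mu>: "phase_law i \<mu>" and h: "h \<in> borel_measurable borel"
  shows "(\<integral>\<^sup>+\<omega>. indicator (A \<inter> {\<omega>\<in>space M. J (d \<omega>) \<omega> = Some i}) \<omega> * h (S \<omega> - d \<omega>) \<partial>M) =
    emeasure M (A \<inter> {\<omega>\<in>space M. J (d \<omega>) \<omega> = Some i}) * (\<integral>\<^sup>+r. h r \<partial>\<mu>)"
proof -
  let ?B = "A \<inter> {\<omega>\<in>space M. J (d \<omega>) \<omega> = Some i}"
  have B: "?B \<in> sets M" by (rule one_time_random_sets[OF A])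
  have R: "(\<lambda>\<omega>. S \<omega> - d \<omega>) \<in> borel_measurable M"
    using S_measurable measurable_H_imp_M[OF d_measurable] by simp
  have h\<mu>: "h \<in> borel_measurable \<mu>"
    using h \<mu> by (simp add: phase_law_def cong: measurable_cong_sets)
  define \<nu> where "\<nu> = distr (density M (indicator ?B)) borel (\<lambda>\<omega>. S \<omega> - d \<omega>)"
  have "\<nu> = scale_measure (emeasure M ?B) \<mu>"
  proof (rule measure_eqI_lessThan)
    show "sets \<nu> = sets borel" by (simp add: \<nu>_def)
    show "sets (scale_measure (emeasure M ?B) \<mu>) = sets borel"
      using \<mu> by (simp add: phase_law_def)
  next
    fix s :: real
    have "emeasure \<nu> {s<..} = emeasure (density M (indicator ?B)) ((\<lambda>\<omega>. S \<omega> - d \<omega>) -` {s<..} \<inter> space M)"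
      unfolding \<nu>_def using R by (subst emeasure_distr) auto
    also have "\<dots> = (\<integral>\<^sup>+\<omega>. indicator ?B \<omega> * indicator ((\<lambda>\<omega>. S \<omega> - d \<omega>) -` {s<..} \<inter> space M) \<omega> \<partial>M)"
      using B R by (subst emeasure_density) auto
    also have "\<dots> = (\<integral>\<^sup>+\<omega>. indicator (A \<inter> {\<omega>\<in>space M. J (d \<omega>) \<omega> = Some i \<and> s < S \<omega> - d \<omega>}) \<omega> \<partial>M)"
      by (intro nn_integral_cong) (auto simp: indicator_def)
    also have "\<dots> = emeasure M (A \<inter> {\<omega>\<in>space M. J (d \<omega>) \<omega> = Some i \<and> s < S \<omega> - d \<omega>})"
    proof (intro nn_integral_indicator)
      have "A \<inter> {\<omega>\<in>space M. J (d \<omega>) \<omega> = Some i \<and> s < S \<omega> - d \<omega>} =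
          ?B \<inter> ((\<lambda>\<omega>. S \<omega> - d \<omega>) -` {s<..} \<inter> space M)" by auto
      then show "A \<inter> {\<omega>\<in>space M. J (d \<omega>) \<omega> = Some i \<and> s < S \<omega> - d \<omega>} \<in> sets M"
        using B measurable_sets[OF R, of "{s<..}"] by simp
    qed
    also have "\<dots> = emeasure M ?B * emeasure \<mu> {s<..}"
      using \<mu> by (simp add: emeasure_residual[OF A] phase_law_def)
    finally have e: "emeasure \<nu> {s<..} = emeasure M ?B * emeasure \<mu> {s<..}" .
    then show "emeasure \<nu> {s<..} = emeasure (scale_measure (emeasure M ?B) \<mu>) {s<..}"
      by simp
    show "emeasure \<nu> {s<..} < \<infinity>"
      unfolding e using \<mu> emeasure_finite[of ?B]
      by (auto simp: phase_law_def ennreal_mult_eq_top_iff less_top[symmetric])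
  qed
  then have "(\<integral>\<^sup>+r. h r \<partial>\<nu>) = emeasure M ?B * (\<integral>\<^sup>+r. h r \<partial>\<mu>)"
    using h\<mu> by (simp add: nn_integral_scale_measure)
  moreover have "(\<integral>\<^sup>+r. h r \<partial>\<nu>) = (\<integral>\<^sup>+\<omega>. indicator ?B \<omega> * h (S \<omega> - d \<omega>) \<partial>M)"
    unfolding \<nu>_def using B R h
    by (subst nn_integral_distr) (auto intro!: nn_integral_density)
  ultimately show ?thesis by simp
qed

lemma emeasure_S_le:
  "emeasure M {\<omega>\<in>space M. S \<omega> \<le> d \<omega>} = (\<integral>\<^sup>+\<omega>. ennreal (\<pi> (d \<omega>) None) \<partial>M)"
proof -
  note [measurable] = measurable_H_imp_M[OF d_measurable] S_measurable
  have "space M \<in> sets H" using sets.top[of H] by (simp add: space_H)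
  note one = one_time_random[OF this, of None]
  have "emeasure M {\<omega>\<in>space M. S \<omega> \<le> d \<omega>} = emeasure M (space M \<inter> {\<omega>\<in>space M. J (d \<omega>) \<omega> = None})"
  proof (rule emeasure_eq_AE)
    show "AE \<omega> in M. \<omega> \<in> {\<omega>\<in>space M. S \<omega> \<le> d \<omega>} \<longleftrightarrow> \<omega> \<in> space M \<inter> {\<omega>\<in>space M. J (d \<omega>) \<omega> = None}"
      using AE_less_S_iff
    proof eventually_elim
      case (elim \<omega>)
      then have "d \<omega> + 0 < S \<omega> \<longleftrightarrow> J (d \<omega> + 0) \<omega> \<noteq> None" by blast
      then show ?case by (auto simp: not_less[symmetric])
    qed
    show "space M \<inter> {\<omega>\<in>space M. J (d \<omega>) \<omega> = None} \<in> sets M"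
      using one_time_random_sets[OF \<open>space M \<in> sets H\<close>] .
  qed measurable
  also have "\<dots> = (\<integral>\<^sup>+\<omega>. ennreal (\<pi> (d \<omega>) None) \<partial>M)"
    unfolding one by (intro nn_integral_cong) simp
  finally show ?thesis .
qed

text \<open>Since the absorption probability is continuous in time, the independent time can be lowered
  by \<open>1 / (k + 1)\<close> at vanishing cost, which leaves no mass for hitting it exactly.\<close>

lemma AE_S_neq: "AE \<omega> in M. 0 < d \<omega> \<longrightarrow> S \<omega> \<noteq> d \<omega>"
proof -
  note [measurable] = measurable_H_imp_M[OF d_measurable] S_measurable
  define e where "e k \<omega> = max 0 (d \<omega> - 1 / real (Suc k))" for k \<omega>
  have e: "independent_time Q M p J H (e k)" for k
  proof
    show "e k \<in> borel_measurable H"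
      unfolding e_def[abs_def] using d_measurable by measurable
  qed (use chain space_H sets_H indep in \<open>auto simp: e_def\<close>)
  have e_le: "emeasure M {\<omega>\<in>space M. S \<omega> \<le> e k \<omega>} = (\<integral>\<^sup>+\<omega>. ennreal (\<pi> (e k \<omega>) None) \<partial>M)" for k
    by (rule independent_time.emeasure_S_le[OF e])
  have [measurable]: "e k \<in> borel_measurable M" for k
    unfolding e_def by measurable
  let ?E = "{\<omega>\<in>space M. 0 < d \<omega> \<and> S \<omega> = d \<omega>}"
  have E: "?E \<in> sets M" by measurable
  have le: "emeasure M ?E + (\<integral>\<^sup>+\<omega>. ennreal (\<pi> (e k \<omega>) None) \<partial>M) \<le> (\<integral>\<^sup>+\<omega>. ennreal (\<pi> (d \<omega>) None) \<partial>M)" for k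
  proof -
    have "emeasure M ?E + emeasure M {\<omega>\<in>space M. S \<omega> \<le> e k \<omega>} =
        emeasure M (?E \<union> {\<omega>\<in>space M. S \<omega> \<le> e k \<omega>})"
    proof (rule plus_emeasure)
      have "e k \<omega> < d \<omega>" if "0 < d \<omega>" for \<omega>
        using that by (simp add: e_def)
      then show "?E \<inter> {\<omega>\<in>space M. S \<omega> \<le> e k \<omega>} = {}"
        by fastforce
    qed measurable
    also have "\<dots> \<le> emeasure M {\<omega>\<in>space M. S \<omega> \<le> d \<omega>}"
    proof (rule emeasure_mono)
      have "e k \<omega> \<le> d \<omega>" if "\<omega> \<in> space M" for \<omega>
        using d_nonneg[OF that] by (simp add: e_def)
      then show "?E \<union> {\<omega>\<in>space M. S \<omega> \<le> e k \<omega>} \<subseteq> {\<omega>\<in>space M. S \<omega> \<le> d \<omega>}"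
        by fastforce
    qed measurable
    finally show ?thesis by (simp add: e_le emeasure_S_le)
  qed
  have lim: "(\<lambda>k. \<integral>\<^sup>+\<omega>. ennreal (\<pi> (e k \<omega>) None) \<partial>M) \<longlonglongrightarrow> (\<integral>\<^sup>+\<omega>. ennreal (\<pi> (d \<omega>) None) \<partial>M)"
  proof (rule nn_integral_dominated_convergence[where w="\<lambda>_. 1"])
    show "(\<lambda>\<omega>. ennreal (\<pi> (e k \<omega>) None)) \<in> borel_measurable M" for k
      by (intro measurable_compose[OF _ measurable_ennreal] law_measurable) measurable
    show "(\<lambda>\<omega>. ennreal (\<pi> (d \<omega>) None)) \<in> borel_measurable M"
      by (intro measurable_compose[OF _ measurable_ennreal] law_measurable) measurable
    show "AE \<omega> in M. ennreal (\<pi> (e k \<omega>) None) \<le> 1" for k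
      using law_at_le_1[OF chain, of "e k _" None] by (simp add: e_def)
    show "AE \<omega> in M. (\<lambda>k. ennreal (\<pi> (e k \<omega>) None)) \<longlonglongrightarrow> ennreal (\<pi> (d \<omega>) None)"
    proof (rule AE_I2)
      fix \<omega> assume \<omega>: "\<omega> \<in> space M"
      have "(\<lambda>k. max 0 (d \<omega> - inverse (real (Suc k)))) \<longlonglongrightarrow> max 0 (d \<omega> - 0)"
        by (intro tendsto_intros LIMSEQ_inverse_real_of_nat)
      then have "(\<lambda>k. e k \<omega>) \<longlonglongrightarrow> d \<omega>"
        using d_nonneg[OF \<omega>] by (simp add: e_def inverse_eq_divide max_def)
      then show "(\<lambda>k. ennreal (\<pi> (e k \<omega>) None)) \<longlonglongrightarrow> ennreal (\<pi> (d \<omega>) None)"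
        by (intro tendsto_ennrealI isCont_tendsto_compose[OF isCont_law_at])
    qed
    show "(\<integral>\<^sup>+\<omega>. 1 \<partial>M) < \<infinity>" by (simp add: emeasure_space_1)
  qed simp
  have "emeasure M ?E + (\<integral>\<^sup>+\<omega>. ennreal (\<pi> (d \<omega>) None) \<partial>M) \<le> 0 + (\<integral>\<^sup>+\<omega>. ennreal (\<pi> (d \<omega>) None) \<partial>M)"
    using le by (intro LIMSEQ_le_const2[OF tendsto_add[OF tendsto_const lim]]) auto
  moreover have "(\<integral>\<^sup>+\<omega>. ennreal (\<pi> (d \<omega>) None) \<partial>M) \<noteq> \<top>"
    unfolding emeasure_S_le[symmetric] by simp
  ultimately have "emeasure M ?E \<le> 0"
    using ennreal_add_left_cancel_le[of "\<integral>\<^sup>+\<omega>. ennreal (\<pi> (d \<omega>) None) \<partial>M" "emeasure M ?E" 0]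
    by (simp only: add.commute[of _ "\<integral>\<^sup>+\<omega>. ennreal (\<pi> (d \<omega>) None) \<partial>M"] infinity_ennreal_def) blast
  then have "?E \<in> null_sets M"
    using E by (auto simp: null_sets_def)
  then show ?thesis by (rule AE_I') auto
qed

end

section \<open>Crossing a threshold, path by path\<close>

locale AR_kernel = phase_type_AR M Q \<alpha> lam J T + phase_type_kernel Q
  for M :: "'a measure" and Q :: "real^'m^'m" and \<alpha> :: "real^'m" and lam :: real
    and J :: "nat \<Rightarrow> real \<Rightarrow> 'a \<Rightarrow> 'm option" and T :: "nat \<Rightarrow> 'a \<Rightarrow> real"
begin

text \<open>\<open>level c x n\<close> is the value that the time \<open>S (n + 1)\<close> has to exceed for the process to
  jump above \<open>c\<close> at time \<open>n + 1\<close>; for \<open>0 \<le> c\<close> it is positive while the process is below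
  \<open>c\<close>, and the truncation at \<open>0\<close> only keeps it nonnegative elsewhere.\<close>

definition level :: "real \<Rightarrow> real \<Rightarrow> nat \<Rightarrow> 'a \<Rightarrow> real" where
  "level c x n \<omega> = max 0 (c - lam * X x n \<omega> + T (Suc n) \<omega>)"

definition below :: "real \<Rightarrow> real \<Rightarrow> nat \<Rightarrow> 'a set" where
  "below c x n = {\<omega>\<in>space M. \<forall>k\<le>n. X x k \<omega> < c}"

definition cross :: "real \<Rightarrow> real \<Rightarrow> 'm \<Rightarrow> nat \<Rightarrow> 'a set" where
  "cross c x i n = below c x n \<inter> {\<omega>\<in>space M. J (Suc n) (level c x n \<omega>) \<omega> = Some i}"

text \<open>The last condition excludes that \<open>X\<close> hits \<open>c\<close> exactly: at the moment when it
  should reach \<open>c\<close>, \<open>Y\<close> may then already have jumped down again, so that \<open>\<tau>\<close> and \<open>\<tau>_hat\<close> need not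
  belong to the same crossing.\<close>

definition generic :: "real \<Rightarrow> real \<Rightarrow> 'a \<Rightarrow> bool" where
  "generic c x \<omega> \<longleftrightarrow> \<omega> \<in> space M \<and> (\<forall>k\<ge>1. absorbed_path (\<lambda>t. J k t \<omega>) \<and> J k 0 \<omega> \<noteq> None) \<and>
    (\<forall>n. 0 < level c x n \<omega> \<longrightarrow> S (Suc n) \<omega> \<noteq> level c x n \<omega>)"

lemma less_S_iff:
  assumes "generic c x \<omega>" "1 \<le> k" "0 \<le> u"
  shows "u < S k \<omega> \<longleftrightarrow> J k u \<omega> \<noteq> None"
  using assms less_absorption_time_iff[OF markov_chain_right_constant[OF chain[OF assms(2)]]]
  by (simp add: generic_def S_def)

lemma S_pos:
  assumes "generic c x \<omega>" "1 \<le> k"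
  shows "0 < S k \<omega>"
  using less_S_iff[OF assms order_refl] assms by (simp add: generic_def)

definition time :: "nat \<Rightarrow> 'a \<Rightarrow> real" where
  "time m \<omega> = (\<Sum>k=1..m. S k \<omega>)"

lemma time_0: "time 0 \<omega> = 0"
  and time_Suc: "time (Suc m) \<omega> = time m \<omega> + S (Suc m) \<omega>"
  by (simp_all add: time_def)

lemma time_strict_mono:
  assumes "generic c x \<omega>"
  shows "strict_mono (\<lambda>m. time m \<omega>)"
  using S_pos[OF assms] by (simp add: strict_mono_Suc_iff time_Suc)

lemma n\<^sub>t_eq:
  assumes g: "generic c x \<omega>" and t: "time k \<omega> \<le> t" "t < time (Suc k) \<omega>"
  shows "n\<^sub>t t \<omega> = k"
proof -
  have "{n. time n \<omega> \<le> t} = {..k}"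
  proof (intro set_eqI iffI)
    fix n assume "n \<in> {n. time n \<omega> \<le> t}"
    then have "time n \<omega> < time (Suc k) \<omega>" using t by simp
    then have "n < Suc k" using strict_mono_less[OF time_strict_mono[OF g]] by blast
    then show "n \<in> {..k}" by simp
  next
    fix n assume "n \<in> {..k}"
    then have "time n \<omega> \<le> time k \<omega>"
      using strict_mono_less_eq[OF time_strict_mono[OF g]] by simp
    then show "n \<in> {n. time n \<omega> \<le> t}" using t by simp
  qed
  then show ?thesis
    unfolding n\<^sub>t_def time_def[symmetric] by (simp add: Max_eq_iff)
qed

lemma Y_eq:
  assumes "generic c x \<omega>" "time k \<omega> \<le> t" "t < time (Suc k) \<omega>"
  shows "Y x t \<omega> = lam * X x k \<omega> - T (Suc k) \<omega> + (t - time k \<omega>)"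
  unfolding Y_def n\<^sub>t_eq[OF assms] time_def by simp

lemma \<tau>_eq_iff:
  "\<tau> c x \<omega> = enat m \<longleftrightarrow> c \<le> X x m \<omega> \<and> (\<forall>k<m. X x k \<omega> < c)"
proof
  assume \<tau>: "\<tau> c x \<omega> = enat m"
  let ?A = "{n. c \<le> X x n \<omega>}"
  have "?A \<noteq> {}"
  proof
    assume "?A = {}"
    then have "\<tau> c x \<omega> = \<infinity>" unfolding \<tau>_def by (simp add: Inf_enat_def)
    then show False using \<tau> by simp
  qed
  then obtain n where "n \<in> ?A" by blast
  then have "Inf (enat ` ?A) \<in> enat ` ?A"
    unfolding Inf_enat_def using LeastI[of "\<lambda>z. z \<in> enat ` ?A" "enat n"] by auto
  then have "enat m \<in> enat ` ?A" using \<tau> by (simp add: \<tau>_def)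
  then have "c \<le> X x m \<omega>" by auto
  moreover have "X x k \<omega> < c" if "k < m" for k
  proof (rule ccontr)
    assume "\<not> X x k \<omega> < c"
    then have "\<tau> c x \<omega> \<le> enat k" unfolding \<tau>_def by (intro INF_lower) auto
    then show False using \<tau> that by simp
  qed
  ultimately show "c \<le> X x m \<omega> \<and> (\<forall>k<m. X x k \<omega> < c)" by blast
next
  assume *: "c \<le> X x m \<omega> \<and> (\<forall>k<m. X x k \<omega> < c)"
  show "\<tau> c x \<omega> = enat m"
    unfolding \<tau>_def
  proof (rule antisym)
    show "(INF n\<in>{n. c \<le> X x n \<omega>}. enat n) \<le> enat m"
      using * by (intro INF_lower) auto
    show "enat m \<le> (INF n\<in>{n. c \<le> X x n \<omega>}. enat n)"
      using * by (intro INF_greatest) (auto simp: not_less[symmetric])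
  qed
qed

lemma level_below:
  assumes c: "0 \<le> c" and \<omega>: "\<omega> \<in> below c x n"
  shows "level c x n \<omega> = c - lam * X x n \<omega> + T (Suc n) \<omega>" "0 < level c x n \<omega>"
proof -
  have X: "X x n \<omega> < c" using \<omega> by (simp add: below_def)
  have "lam * X x n \<omega> < c"
  proof (cases "X x n \<omega> \<le> 0")
    case True
    show ?thesis
    proof (cases "c = 0")
      case True
      then show ?thesis using X lam by (simp add: mult_pos_neg)
    next
      case False
      have "lam * X x n \<omega> \<le> 0" using True lam by (simp add: mult_nonneg_nonpos)
      then show ?thesis using False c by simp
    qed
  next
    case False
    then have "lam * X x n \<omega> < 1 * X x n \<omega>" using lam by (intro mult_strict_right_mono) auto
    then show ?thesis using X by simp
  qed
  moreover have "0 \<le> T (Suc n) \<omega>" using T_nonneg[of "Suc n"] \<omega> by (simp add: below_def)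
  ultimately show "level c x n \<omega> = c - lam * X x n \<omega> + T (Suc n) \<omega>" "0 < level c x n \<omega>"
    by (simp_all add: level_def)
qed

lemma X_Suc_level:
  assumes "0 \<le> c" "\<omega> \<in> below c x n"
  shows "X x (Suc n) \<omega> = c + (S (Suc n) \<omega> - level c x n \<omega>)"
  using level_below(1)[OF assms] by (simp add: Z_def)

text \<open>On a crossing path, \<open>Y\<close> stays below \<open>c\<close> on each earlier piece, since it increases there
  towards a value \<open>X x k \<omega> < c\<close>, and on the last piece it reaches \<open>c\<close> with slope one.\<close>

lemma \<tau>_hat_cross:
  assumes c: "0 \<le> c" and g: "generic c x \<omega>" and \<omega>: "\<omega> \<in> cross c x i n"
  shows "\<tau>_hat c x \<omega> = ereal (time n \<omega> + level c x n \<omega>)"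
    and "J\<^sub>t (time n \<omega> + level c x n \<omega>) \<omega> = Some i"
    and "\<tau> c x \<omega> = enat (Suc n)"
proof -
  have b: "\<omega> \<in> below c x n" and J: "J (Suc n) (level c x n \<omega>) \<omega> = Some i"
    using \<omega> by (auto simp: cross_def)
  note D = level_below[OF c b]
  let ?D = "level c x n \<omega>"
  have lt: "?D < S (Suc n) \<omega>"
    using less_S_iff[OF g, of "Suc n" ?D] D J by simp
  have t1: "time n \<omega> \<le> time n \<omega> + ?D" "time n \<omega> + ?D < time (Suc n) \<omega>"
    using D lt by (auto simp: time_Suc)
  show "J\<^sub>t (time n \<omega> + ?D) \<omega> = Some i"
    unfolding J\<^sub>t_def n\<^sub>t_eq[OF g t1] using J by (simp only: time_def[symmetric]) simp
  show "\<tau> c x \<omega> = enat (Suc n)"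
    unfolding \<tau>_eq_iff X_Suc_level[OF c b] using lt b by (auto simp: below_def less_Suc_eq_le)
  have t0: "0 \<le> time n \<omega>"
    using strict_mono_less_eq[OF time_strict_mono[OF g], of 0 n] by (simp add: time_0)
  have at: "c \<le> Y x (time n \<omega> + ?D) \<omega>"
    using D(1) unfolding Y_eq[OF g t1] by simp
  have before: "Y x t \<omega> < c" if t: "0 \<le> t" "t < time n \<omega> + ?D" for t
  proof -
    define k where "k = Max {k. k \<le> n \<and> time k \<omega> \<le> t}"
    have fin: "finite {k. k \<le> n \<and> time k \<omega> \<le> t}" and ne: "{k. k \<le> n \<and> time k \<omega> \<le> t} \<noteq> {}"
      using t(1) by (auto intro!: exI[of _ 0] simp: time_0)
    have k: "k \<le> n" "time k \<omega> \<le> t"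
      using Max_in[OF fin ne] by (auto simp: k_def)
    show ?thesis
    proof (cases "k = n")
      case True
      have "Y x t \<omega> = lam * X x n \<omega> - T (Suc n) \<omega> + (t - time n \<omega>)"
        using k True t t1 by (intro Y_eq[OF g]) auto
      also have "\<dots> < c" using t D(1) by simp
      finally show ?thesis .
    next
      case False
      have "\<not> time (Suc k) \<omega> \<le> t"
      proof
        assume "time (Suc k) \<omega> \<le> t"
        then have "Suc k \<le> k"
          unfolding k_def using False k by (intro Max_ge[OF fin]) (auto simp flip: k_def)
        then show False by simp
      qed
      then have t2: "t < time (Suc k) \<omega>" by simp
      have "Y x t \<omega> < X x (Suc k) \<omega>"
        unfolding Y_eq[OF g k(2) t2] using t2 by (simp add: time_Suc Z_def)
      moreover have "Suc k \<le> n" using k False by simp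
      then have "X x (Suc k) \<omega> < c"
        using b unfolding below_def by blast
      ultimately show ?thesis by simp
    qed
  qed
  show "\<tau>_hat c x \<omega> = ereal (time n \<omega> + ?D)"
    unfolding \<tau>_hat_def
  proof (rule antisym)
    show "(INF t\<in>{t. 0 \<le> t \<and> c \<le> Y x t \<omega>}. ereal t) \<le> ereal (time n \<omega> + ?D)"
      using at t0 D by (intro INF_lower) auto
    show "ereal (time n \<omega> + ?D) \<le> (INF t\<in>{t. 0 \<le> t \<and> c \<le> Y x t \<omega>}. ereal t)"
      using before by (intro INF_greatest) (force simp: not_less[symmetric])
  qed
qed

lemma cross_imp_G:
  assumes "0 \<le> c" "generic c x \<omega>" "\<omega> \<in> cross c x i n"
  shows "\<omega> \<in> G j c x \<longleftrightarrow> j = i"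
  using \<tau>_hat_cross[OF assms] assms(3) by (auto simp: G_def cross_def)

lemma \<tau>_imp_cross:
  assumes c: "0 \<le> c" and g: "generic c x \<omega>" and \<tau>: "\<tau> c x \<omega> = enat (Suc n)"
  shows "\<exists>i. \<omega> \<in> cross c x i n"
proof -
  have b: "\<omega> \<in> below c x n" and X: "c \<le> X x (Suc n) \<omega>"
    using \<tau> g unfolding \<tau>_eq_iff by (auto simp: below_def generic_def)
  note D = level_below[OF c b]
  have "level c x n \<omega> \<le> S (Suc n) \<omega>"
    using X unfolding X_Suc_level[OF c b] by simp
  moreover have "S (Suc n) \<omega> \<noteq> level c x n \<omega>"
    using g D(2) by (auto simp: generic_def)
  ultimately have "level c x n \<omega> < S (Suc n) \<omega>" by simp
  then have "J (Suc n) (level c x n \<omega>) \<omega> \<noteq> None"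
    using less_S_iff[OF g, of "Suc n"] D(2) by simp
  then show ?thesis
    using b g by (auto simp: cross_def generic_def)
qed

lemma cross_unique:
  assumes "0 \<le> c" "generic c x \<omega>" "\<omega> \<in> cross c x i n" "\<omega> \<in> cross c x j m"
  shows "m = n" "i = j"
proof -
  show "m = n"
    using \<tau>_hat_cross(3)[OF assms(1-3)] \<tau>_hat_cross(3)[OF assms(1,2,4)] by simp
  then show "i = j" using assms by (simp add: cross_def)
qed

section \<open>Independence of one chain from all other sources\<close>

definition source :: "nat + nat \<Rightarrow> 'a set set" where
  "source = case_sum
     (\<lambda>n. {(\<lambda>\<omega>. \<lambda>t\<in>{0..}. J n t \<omega>) -` A \<inter> space M | A. A \<in> sets (PiM {0..} (\<lambda>_. count_space UNIV))})
     (\<lambda>n. {T n -` A \<inter> space M | A. A \<in> sets borel})"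

text \<open>\<open>T n\<close> is counted among the other sources, since the level that \<open>S n\<close> has to exceed depends on it.\<close>

definition others :: "nat \<Rightarrow> 'a measure" where
  "others n = sigma (space M) (\<Union>i\<in>({1..} <+> {1..}) - {Inl n}. source i)"

lemma indep_source: "indep_sets source ({1..} <+> {1..})"
  using independent by (simp only: source_def)

lemma source_events: "i \<in> {1..} <+> {1..} \<Longrightarrow> source i \<subseteq> events"
  using indep_source unfolding indep_sets_def by blast

lemma sets_others: "sets (others n) = sigma_sets (space M) (\<Union>i\<in>({1..} <+> {1..}) - {Inl n}. source i)"
  and space_others: "space (others n) = space M"
proof -
  have "(\<Union>i\<in>({1..} <+> {1..}) - {Inl n}. source i) \<subseteq> Pow (space M)"
    using source_events sets.sets_into_space by blast
  then show "sets (others n) = sigma_sets (space M) (\<Union>i\<in>({1..} <+> {1..}) - {Inl n}. source i)"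
    "space (others n) = space M"
    by (simp_all add: others_def)
qed

lemma others_events: "sets (others n) \<subseteq> events"
  unfolding sets_others
  by (intro sets.sigma_sets_subset UN_least source_events) auto

lemma source_others:
  "i \<in> ({1..} <+> {1..}) - {Inl n} \<Longrightarrow> B \<in> source i \<Longrightarrow> B \<in> sets (others n)"
  unfolding sets_others by (intro sigma_sets.Basic) blast

lemma Int_stable_preimages: "Int_stable {f -` A \<inter> \<Omega> | A. A \<in> sets N}"
proof (rule Int_stableI)
  fix a b assume "a \<in> {f -` A \<inter> \<Omega> | A. A \<in> sets N}" "b \<in> {f -` A \<inter> \<Omega> | A. A \<in> sets N}"
  then obtain A B where "A \<in> sets N" "B \<in> sets N" "a = f -` A \<inter> \<Omega>" "b = f -` B \<inter> \<Omega>" by blast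
  then have "a \<inter> b = f -` (A \<inter> B) \<inter> \<Omega>" "A \<inter> B \<in> sets N" by auto
  then show "a \<inter> b \<in> {f -` A \<inter> \<Omega> | A. A \<in> sets N}" by blast
qed

lemma Int_stable_source: "Int_stable (source i)"
  unfolding source_def by (cases i) (simp_all only: sum.case Int_stable_preimages)

lemma indep_others:
  assumes n: "1 \<le> n" and A: "A \<in> sets (others n)" and B: "B \<in> source (Inl n)"
  shows "prob (A \<inter> B) = prob A * prob B"
proof -
  define I :: "bool \<Rightarrow> (nat + nat) set" where "I b = (if b then ({1..} <+> {1..}) - {Inl n} else {Inl n})" for b
  have "indep_sets (\<lambda>b. sigma_sets (space M) (\<Union>i\<in>I b. source i)) UNIV"
  proof (rule indep_sets_collect_sigma)
    have "(\<Union>b. I b) = {1..} <+> {1..}"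
      using n by (auto simp: I_def UNIV_bool)
    then show "indep_sets source (\<Union>b. I b)"
      using indep_source by simp
  qed (auto simp: Int_stable_source disjoint_family_on_def I_def)
  then have "prob (\<Inter>b\<in>UNIV. if b then A else B) = (\<Prod>b\<in>UNIV. prob (if b then A else B))"
  proof (rule indep_setsD)
    show "\<forall>b\<in>UNIV. (if b then A else B) \<in> sigma_sets (space M) (\<Union>i\<in>I b. source i)"
      using A B by (auto simp: I_def sets_others)
  qed auto
  then show ?thesis by (simp add: UNIV_bool mult.commute Int_commute)
qed

lemma state_source:
  assumes "0 \<le> t" "0 \<le> u"
  shows "{\<omega>\<in>space M. J n t \<omega> \<in> B \<and> J n u \<omega> \<in> C} \<in> source (Inl n)"
proof -
  let ?N = "PiM {0..} (\<lambda>_. count_space UNIV) :: (real \<Rightarrow> 'm option) measure"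
  have c: "(\<lambda>w. w t) \<in> measurable ?N (count_space UNIV)" "(\<lambda>w. w u) \<in> measurable ?N (count_space UNIV)"
    using assms by (auto intro!: measurable_component_singleton)
  have "{w\<in>space ?N. w t \<in> B \<and> w u \<in> C} = ((\<lambda>w. w t) -` B \<inter> space ?N) \<inter> ((\<lambda>w. w u) -` C \<inter> space ?N)"
    by auto
  also have "\<dots> \<in> sets ?N"
    by (intro sets.Int measurable_sets[OF c(1)] measurable_sets[OF c(2)]) auto
  finally have "{w\<in>space ?N. w t \<in> B \<and> w u \<in> C} \<in> sets ?N" .
  moreover have "{\<omega>\<in>space M. J n t \<omega> \<in> B \<and> J n u \<omega> \<in> C} =
      (\<lambda>\<omega>. \<lambda>t\<in>{0..}. J n t \<omega>) -` {w\<in>space ?N. w t \<in> B \<and> w u \<in> C} \<inter> space M"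
    using assms by (auto simp: space_PiM)
  ultimately show ?thesis unfolding source_def sum.case by blast
qed

lemma J_others:
  assumes "1 \<le> k" "k \<noteq> n" "0 \<le> t"
  shows "J k t \<in> measurable (others n) (count_space UNIV)"
proof (rule measurableI)
  fix B :: "'m option set"
  have "J k t -` B \<inter> space (others n) = {\<omega>\<in>space M. J k t \<omega> \<in> B \<and> J k t \<omega> \<in> B}"
    by (auto simp: space_others)
  also have "\<dots> \<in> sets (others n)"
    using assms by (intro source_others[OF _ state_source]) auto
  finally show "J k t -` B \<inter> space (others n) \<in> sets (others n)" .
qed simp

lemma S_others: "1 \<le> k \<Longrightarrow> k \<noteq> n \<Longrightarrow> S k \<in> borel_measurable (others n)"
  unfolding S_def[abs_def]
  by (intro measurable_absorption_time J_others) 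
    (auto simp: space_others intro: markov_chain_right_constant[OF chain])

lemma T_others: "1 \<le> k \<Longrightarrow> T k \<in> borel_measurable (others n)"
proof (rule measurableI)
  fix B :: "real set" assume "1 \<le> k" "B \<in> sets borel"
  then show "T k -` B \<inter> space (others n) \<in> sets (others n)"
    by (intro source_others[of "Inr k"]) (auto simp: space_others source_def)
qed simp

lemma X_others: "m < n \<Longrightarrow> X x m \<in> borel_measurable (others n)"
proof (induction m)
  case 0
  have "X x 0 = (\<lambda>\<omega>. x)" by auto
  then show ?case by simp
next
  case (Suc m)
  have "X x (Suc m) = (\<lambda>\<omega>. lam * X x m \<omega> + (S (Suc m) \<omega> - T (Suc m) \<omega>))"
    by (auto simp: Z_def)
  then show ?case
    using Suc S_others[of "Suc m" n] T_others[of "Suc m" n] by simp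
qed

lemma level_others: "level c x n \<in> borel_measurable (others (Suc n))"
  unfolding level_def[abs_def]
  using X_others[of n "Suc n" x] T_others[of "Suc n" "Suc n"] by simp

lemma below_others: "below c x n \<in> sets (others (Suc n))"
proof -
  have "below c x n = (\<Inter>k\<in>{..n}. {\<omega>\<in>space (others (Suc n)). X x k \<omega> < c})"
    by (auto simp: below_def space_others)
  also have "\<dots> \<in> sets (others (Suc n))"
    using X_others[of _ "Suc n" x] by (intro sets.finite_INT) (auto simp: less_Suc_eq_le)
  finally show ?thesis .
qed

lemma independent_time_level:
  "independent_time Q M (hat_vector \<alpha>) (J (Suc n)) (others (Suc n)) (level c x n)"
proof
  show "markov_chain M (hat_matrix Q) (hat_vector \<alpha>) (J (Suc n))"
    by (rule chain) simp
  fix A t u i j assume "A \<in> sets (others (Suc n))" "0 \<le> (t::real)" "t \<le> u"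
  then show "prob (A \<inter> {\<omega>\<in>space M. J (Suc n) t \<omega> = i \<and> J (Suc n) u \<omega> = j}) =
      prob A * prob {\<omega>\<in>space M. J (Suc n) t \<omega> = i \<and> J (Suc n) u \<omega> = j}"
    using state_source[of t u "Suc n" "{i}" "{j}"] by (intro indep_others) auto
qed (simp_all add: space_others others_events level_others, simp add: level_def)

lemma AE_generic: "AE \<omega> in M. generic c x \<omega>"
proof -
  have "AE \<omega> in M. \<forall>k. absorbed_path (\<lambda>t. J (Suc k) t \<omega>) \<and> J (Suc k) 0 \<omega> \<noteq> None"
    unfolding AE_all_countable
  proof
    fix k
    have mc: "markov_chain M (hat_matrix Q) (hat_vector \<alpha>) (J (Suc k))"
      by (rule chain) simp
    have "J (Suc k) 0 \<in> measurable M (count_space UNIV)"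
      using mc by (simp add: markov_chain_def)
    then have "{\<omega>\<in>space M. J (Suc k) 0 \<omega> = None} \<in> events" by simp
    moreover have "prob {\<omega>\<in>space M. J (Suc k) 0 \<omega> = None} = 0"
      using markov_chain_one_time[OF mc order_refl, of None]
      by (simp add: law_at_def matrix_exp_0 hat_vector_def if_distrib[of "\<lambda>x. _ * x"] cong: if_cong)
    ultimately have "{\<omega>\<in>space M. J (Suc k) 0 \<omega> = None} \<in> null_sets M"
      by (auto simp: null_sets_def emeasure_eq_measure)
    then have "AE \<omega> in M. J (Suc k) 0 \<omega> \<noteq> None"
      by (rule AE_I') auto
    then show "AE \<omega> in M. absorbed_path (\<lambda>t. J (Suc k) t \<omega>) \<and> J (Suc k) 0 \<omega> \<noteq> None"
      using AE_absorbed_path[OF mc] by eventually_elim simp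
  qed
  moreover have "AE \<omega> in M. \<forall>n. 0 < level c x n \<omega> \<longrightarrow> S (Suc n) \<omega> \<noteq> level c x n \<omega>"
    unfolding AE_all_countable S_def
    using independent_time.AE_S_neq[OF independent_time_level] by blast
  ultimately show ?thesis
    using AE_space
  proof eventually_elim
    case (elim \<omega>)
    then show ?case
      unfolding generic_def by (metis Suc_le_D One_nat_def)
  qed
qed

section \<open>The payoff of a threshold rule\<close>

lemma cross_events: "cross c x i n \<in> events"
  unfolding cross_def
  by (rule independent_time.one_time_random_sets[OF independent_time_level below_others])

lemma crossing_sum:
  fixes f :: "nat \<Rightarrow> ennreal"
  assumes "0 \<le> c" "generic c x \<omega>"
  shows "\<omega> \<in> cross c x i m \<Longrightarrow> (\<Sum>n. indicator (cross c x i n) \<omega> * f n) = f m"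
    and "(\<And>n. \<omega> \<notin> cross c x i n) \<Longrightarrow> (\<Sum>n. indicator (cross c x i n) \<omega> * f n) = 0"
proof -
  assume m: "\<omega> \<in> cross c x i m"
  have "(\<Sum>n. indicator (cross c x i n) \<omega> * f n) = (\<Sum>n\<in>{m}. indicator (cross c x i n) \<omega> * f n)"
  proof (rule suminf_finite)
    fix n assume "n \<notin> {m}"
    then have "\<omega> \<notin> cross c x i n"
      using cross_unique(1)[OF assms m] by blast
    then show "indicator (cross c x i n) \<omega> * f n = 0" by simp
  qed simp
  then show "(\<Sum>n. indicator (cross c x i n) \<omega> * f n) = f m" using m by simp
qed simp

lemma crossing_cases:
  assumes "x < c" "0 \<le> c" "generic c x \<omega>"
  obtains (infinite) "\<tau> c x \<omega> = \<infinity>" "\<And>i n. \<omega> \<notin> cross c x i n"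
    | (finite) n i where "\<tau> c x \<omega> = enat (Suc n)" "\<omega> \<in> cross c x i n"
proof (cases "\<tau> c x \<omega>")
  case infinity
  have "\<omega> \<notin> cross c x i n" for i n
    using \<tau>_hat_cross(3)[OF assms(2,3), of i n] infinity by auto
  then show ?thesis using that infinity by blast
next
  case (enat m)
  have "c \<le> X x m \<omega>" using enat by (simp add: \<tau>_eq_iff)
  then have "m \<noteq> 0" using assms(1) by (cases m) auto
  then obtain n where "m = Suc n" by (cases m) auto
  then show ?thesis using \<tau>_imp_cross[OF assms(2,3), of n] enat that by blast
qed

text \<open>Where \<open>\<tau>\<close> is finite, \<open>G i c x\<close> agrees up to a null set with the union over \<open>n\<close> of the
  measurable events \<open>cross c x i n\<close>, on which \<open>\<tau>\<close> has the value \<open>n + 1\<close>.\<close>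

lemma \<Phi>_series:
  assumes c: "0 \<le> c" and x: "x < c"
  shows "\<Phi> \<rho> i c x = (\<Sum>n. emeasure M (cross c x i n) * ennreal (\<rho> ^ Suc n))"
proof -
  have "\<Phi> \<rho> i c x = (\<integral>\<^sup>+\<omega>. (\<Sum>n. indicator (cross c x i n) \<omega> * ennreal (\<rho> ^ Suc n)) \<partial>M)"
    unfolding \<Phi>_def
  proof (rule nn_integral_cong_AE)
    show "AE \<omega> in M. (case \<tau> c x \<omega> of enat n \<Rightarrow> ennreal (\<rho> ^ n) | \<infinity> \<Rightarrow> 0) * indicator (G i c x) \<omega> =
        (\<Sum>n. indicator (cross c x i n) \<omega> * ennreal (\<rho> ^ Suc n))"
      using AE_generic[of c x]
    proof eventually_elim
      case (elim \<omega>)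
      show ?case
      proof (cases rule: crossing_cases[OF x c elim])
        case 1
        then show ?thesis by (simp add: crossing_sum(2)[OF c elim])
      next
        case (2 m j)
        have G: "\<omega> \<in> G i c x \<longleftrightarrow> i = j"
          by (rule cross_imp_G[OF c elim 2(2)])
        show ?thesis
        proof (cases "i = j")
          case True
          then show ?thesis
            using crossing_sum(1)[OF c elim, of i m "\<lambda>n. ennreal (\<rho> ^ Suc n)"] 2 G by simp
        next
          case False
          have "\<omega> \<notin> cross c x i n" for n
            using cross_unique(2)[OF c elim 2(2)] False by blast
          then show ?thesis using G False by simp
        qed
      qed
    qed
  qed
  also have "\<dots> = (\<Sum>n. \<integral>\<^sup>+\<omega>. indicator (cross c x i n) \<omega> * ennreal (\<rho> ^ Suc n) \<partial>M)"
    using cross_events by (intro nn_integral_suminf) auto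
  also have "\<dots> = (\<Sum>n. emeasure M (cross c x i n) * ennreal (\<rho> ^ Suc n))"
    using cross_events by (intro suminf_cong) (simp add: nn_integral_multc)
  finally show ?thesis .
qed

text \<open>The overshoot over \<open>c\<close> is a residual absorption time, so by loss of memory it enters the payoff
  only through the state in which the threshold is crossed.\<close>

lemma expected_payoff_threshold:
  assumes c: "0 \<le> c" and x: "x < c" and \<rho>: "0 \<le> \<rho>"
    and g: "g \<in> borel_measurable borel"
    and \<mu>: "\<And>i. phase_law i (\<mu> i)"
  shows "expected_payoff \<rho> g x (\<tau> c x) = (\<Sum>i\<in>UNIV. \<Phi> \<rho> i c x * (\<integral>\<^sup>+r. ennreal (g (c + r)) \<partial>\<mu> i))"
proof -
  note [measurable] = cross_events g
  define h where "h r = ennreal (g (c + r))" for r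
  have h [measurable]: "h \<in> borel_measurable borel"
    unfolding h_def[abs_def] by measurable
  have SM [measurable]: "S (Suc n) \<in> borel_measurable M" for n
    unfolding S_def[abs_def] by (rule independent_time.S_measurable[OF independent_time_level])
  have LM [measurable]: "level c x n \<in> borel_measurable M" for n
    by (rule independent_time.measurable_H_imp_M[OF independent_time_level level_others])
  have "expected_payoff \<rho> g x (\<tau> c x) =
      (\<integral>\<^sup>+\<omega>. (\<Sum>i\<in>UNIV. \<Sum>n. indicator (cross c x i n) \<omega> * (ennreal (\<rho> ^ Suc n) * h (S (Suc n) \<omega> - level c x n \<omega>))) \<partial>M)"
    unfolding expected_payoff_def
  proof (rule nn_integral_cong_AE)
    show "AE \<omega> in M. (case \<tau> c x \<omega> of enat n \<Rightarrow> ennreal (\<rho> ^ n * g (X x n \<omega>)) | \<infinity> \<Rightarrow> 0) =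
        (\<Sum>i\<in>UNIV. \<Sum>n. indicator (cross c x i n) \<omega> * (ennreal (\<rho> ^ Suc n) * h (S (Suc n) \<omega> - level c x n \<omega>)))"
      using AE_generic[of c x]
    proof eventually_elim
      case (elim \<omega>)
      let ?f = "\<lambda>n. ennreal (\<rho> ^ Suc n) * h (S (Suc n) \<omega> - level c x n \<omega>)"
      show ?case
      proof (cases rule: crossing_cases[OF x c elim])
        case 1
        then show ?thesis by (simp add: crossing_sum(2)[OF c elim])
      next
        case (2 m j)
        have b: "\<omega> \<in> below c x m" using 2 by (simp add: cross_def)
        have z: "(\<Sum>n. indicator (cross c x i n) \<omega> * ?f n) = (if i = j then ?f m else 0)" for i
        proof (cases "i = j")
          case True
          then show ?thesis
            using crossing_sum(1)[OF c elim, of i m ?f] 2 by simp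
        next
          case False
          have "\<omega> \<notin> cross c x i n" for n
            using cross_unique(2)[OF c elim 2(2)] False by blast
          then show ?thesis using False by simp
        qed
        have "(case \<tau> c x \<omega> of enat n \<Rightarrow> ennreal (\<rho> ^ n * g (X x n \<omega>)) | \<infinity> \<Rightarrow> 0) =
            ennreal (\<rho> ^ Suc m * g (X x (Suc m) \<omega>))"
          using 2 by simp
        also have "\<dots> = ?f m"
          unfolding X_Suc_level[OF c b] h_def using \<rho> by (intro ennreal_mult') simp
        finally show ?thesis unfolding z by simp
      qed
    qed
  qed
  also have "\<dots> = (\<Sum>i\<in>UNIV. \<Sum>n. \<integral>\<^sup>+\<omega>. indicator (cross c x i n) \<omega> * (ennreal (\<rho> ^ Suc n) * h (S (Suc n) \<omega> - level c x n \<omega>)) \<partial>M)"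
    by (simp add: nn_integral_sum nn_integral_suminf)
  also have "\<dots> = (\<Sum>i\<in>UNIV. \<Sum>n. emeasure M (cross c x i n) * ennreal (\<rho> ^ Suc n) * (\<integral>\<^sup>+r. h r \<partial>\<mu> i))"
  proof (intro sum.cong suminf_cong refl)
    fix i n
    have "(\<integral>\<^sup>+\<omega>. indicator (cross c x i n) \<omega> * (ennreal (\<rho> ^ Suc n) * h (S (Suc n) \<omega> - level c x n \<omega>)) \<partial>M) =
        (\<integral>\<^sup>+\<omega>. ennreal (\<rho> ^ Suc n) * (indicator (cross c x i n) \<omega> * h (S (Suc n) \<omega> - level c x n \<omega>)) \<partial>M)"
      by (simp add: mult_ac)
    also have "\<dots> = ennreal (\<rho> ^ Suc n) * (\<integral>\<^sup>+\<omega>. indicator (cross c x i n) \<omega> * h (S (Suc n) \<omega> - level c x n \<omega>) \<partial>M)"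
      by (rule nn_integral_cmult) measurable
    also have "(\<integral>\<^sup>+\<omega>. indicator (cross c x i n) \<omega> * h (S (Suc n) \<omega> - level c x n \<omega>) \<partial>M) =
        emeasure M (cross c x i n) * (\<integral>\<^sup>+r. h r \<partial>\<mu> i)"
      unfolding cross_def S_def
      by (rule independent_time.nn_integral_residual[OF independent_time_level below_others \<mu> h])
    finally show "(\<integral>\<^sup>+\<omega>. indicator (cross c x i n) \<omega> * (ennreal (\<rho> ^ Suc n) * h (S (Suc n) \<omega> - level c x n \<omega>)) \<partial>M) =
        emeasure M (cross c x i n) * ennreal (\<rho> ^ Suc n) * (\<integral>\<^sup>+r. h r \<partial>\<mu> i)"
      by (simp only: mult_ac)
  qed
  also have "\<dots> = (\<Sum>i\<in>UNIV. \<Phi> \<rho> i c x * (\<integral>\<^sup>+r. h r \<partial>\<mu> i))"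
    by (simp add: \<Phi>_series[OF c x])
  finally show ?thesis by (simp add: h_def)
qed

end

section \<open>Reachable states\<close>

context phase_type_kernel
begin

lemma tr_diag_pos:
  assumes t: "0 \<le> t"
  shows "0 < tr t j j"
proof -
  have "((\<lambda>s. tr s j j) \<longlongrightarrow> 1) (at 0)"
    using isCont_tr[of 0 j j] by (simp add: isCont_def tr_0)
  then have "\<forall>\<^sub>F s in at 0. 0 < tr s j j"
    by (rule order_tendstoD) simp
  then obtain \<delta> where \<delta>: "\<delta> > 0" "\<And>s. s \<noteq> 0 \<Longrightarrow> dist s 0 < \<delta> \<Longrightarrow> 0 < tr s j j"
    unfolding eventually_at by blast
  obtain n :: nat where n: "t / \<delta> < real n"
    using reals_Archimedean2 by blast
  define s where "s = t / real (Suc n)"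
  have s0: "0 \<le> s" using t by (simp add: s_def)
  have "t < real n * \<delta>" using n \<delta>(1) by (simp add: pos_divide_less_eq)
  also have "\<dots> \<le> real (Suc n) * \<delta>" using \<delta>(1) by (intro mult_right_mono) auto
  finally have "s < \<delta>"
    unfolding s_def by (simp add: pos_divide_less_eq mult.commute)
  then have s: "0 < tr s j j"
    using \<delta>(2)[of s] s0 by (cases "s = 0") (auto simp: tr_0)
  have "tr s j j ^ k \<le> tr (real k * s) j j" for k
  proof (induction k)
    case (Suc k)
    have "tr s j j ^ Suc k \<le> tr s j j * tr (real k * s) j j"
      using Suc s by simp
    also have "\<dots> \<le> tr (s + real k * s) j j"
      using s0 by (intro tr_add_ge) auto
    finally show ?case by (simp add: algebra_simps)
  qed (simp add: tr_0)
  then have "tr s j j ^ Suc n \<le> tr t j j"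
    by (metis mult.commute nonzero_eq_divide_eq of_nat_0_eq_iff nat.simps(3) s_def)
  then show ?thesis using zero_less_power[OF s, of "Suc n"] by linarith
qed

lemma law_at_add_ge:
  assumes mc: "markov_chain M (hat_matrix Q) p J" and t: "0 \<le> s" "0 \<le> t"
  shows "law_at (hat_matrix Q) p s k * tr t k j \<le> law_at (hat_matrix Q) p (s + t) j"
  unfolding law_at_add[OF mc t]
  using t by (intro member_le_sum[of k UNIV "\<lambda>k. law_at (hat_matrix Q) p s k * tr t k j"])
    (auto simp: tr_nonneg law_at_nonneg[OF mc])

text \<open>A state that carries no mass at one positive time carries none before, because a visited state
  is kept with positive probability. Its mass is a power series in time and so vanishes for ever.\<close>

lemma law_at_zero_imp_zero:
  assumes mc: "markov_chain M (hat_matrix Q) p J"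
    and s: "0 < s" and z: "law_at (hat_matrix Q) p s j = 0"
  shows "law_at (hat_matrix Q) p t j = 0"
proof -
  define c where "c n = (\<Sum>a\<in>UNIV. p $ a * (matrix_power (hat_matrix Q) n $ a $ j / fact n))" for n
  have sums: "(\<lambda>n. c n * t ^ n) sums law_at (hat_matrix Q) p t j" for t
    unfolding c_def law_at_def sum_distrib_right mult.assoc
    by (intro sums_sum sums_mult matrix_exp_entry_sums)
  have "(\<Sum>n. c n * r ^ n) = 0" if r: "0 \<le> r" "r \<le> s" for r
  proof -
    have "law_at (hat_matrix Q) p r j * tr (s - r) j j \<le> law_at (hat_matrix Q) p (r + (s - r)) j"
      using r by (intro law_at_add_ge[OF mc]) auto
    then have "law_at (hat_matrix Q) p r j * tr (s - r) j j \<le> 0" using z by simp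
    then have "law_at (hat_matrix Q) p r j \<le> 0"
      using tr_diag_pos[of "s - r" j] r by (simp add: mult_le_0_iff)
    then have "law_at (hat_matrix Q) p r j = 0"
      using law_at_nonneg[OF mc r(1), of j] by simp
    then show ?thesis using sums_unique[OF sums[of r]] by simp
  qed
  then have "c n = 0" for n
    by (rule powser_coeffs_zero[OF sums_summable[OF sums] s])
  then show ?thesis using sums_unique[OF sums[of t]] by simp
qed

lemma phase_law_unique:
  assumes "phase_law i \<mu>" "phase_law i \<nu>"
  shows "\<mu> = \<nu>"
  using assms by (intro measure_eqI_lessThan) (auto simp: phase_law_def)

text \<open>Running the chain from \<open>i\<close> up to a fixed time \<open>s\<close> and restarting it there bounds a phasetype
  integral by shifted ones.\<close>

lemma nn_integral_phase_law_shift: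
  assumes s: "0 \<le> s" and \<mu>: "\<And>j. phase_law j (\<mu> j)" and h: "h \<in> borel_measurable borel"
    and K: "\<And>r. 0 \<le> r \<Longrightarrow> r \<le> s \<Longrightarrow> h r \<le> K"
  shows "(\<integral>\<^sup>+r. h r \<partial>\<mu> i) \<le> K + (\<Sum>j\<in>UNIV. ennreal (tr s (Some i) (Some j)) * (\<integral>\<^sup>+r. h (s + r) \<partial>\<mu> j))"
proof -
  obtain P :: "(real \<Rightarrow> 'm option) measure"
    where P: "markov_chain P (hat_matrix Q) (axis (Some i) 1) (\<lambda>t \<omega>. \<omega> t)"
    using chain_exists by blast
  interpret prob_space P using P by (simp add: markov_chain_def)
  let ?H = "sigma (space P) {}"
  interpret it: independent_time Q P "axis (Some i) 1" "\<lambda>t \<omega>. \<omega> t" ?H "\<lambda>_. s"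
  proof
    fix A t u k j assume A: "A \<in> sets ?H" and t: "0 \<le> t" "t \<le> (u::real)"
    have "A = {} \<or> A = space P" using A by (auto simp: sigma_sets_empty_eq)
    moreover have "space P \<inter> {\<omega>\<in>space P. \<omega> t = k \<and> \<omega> u = j} = {\<omega>\<in>space P. \<omega> t = k \<and> \<omega> u = j}"
      by auto
    ultimately show "prob (A \<inter> {\<omega>\<in>space P. \<omega> t = k \<and> \<omega> u = j}) = prob A * prob {\<omega>\<in>space P. \<omega> t = k \<and> \<omega> u = j}"
      by (auto simp: prob_space)
  qed (use P s in \<open>auto simp: sigma_sets_empty_eq\<close>)
  have S [measurable]: "absorption_time \<in> borel_measurable P"
    using it.S_measurable by simp
  have A: "space P \<in> sets ?H" by (simp add: sigma_sets_empty_eq)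
  let ?B = "\<lambda>j. space P \<inter> {\<omega>\<in>space P. \<omega> s = Some j}"
  have B [measurable]: "?B j \<in> sets P" for j
    by (rule it.one_time_random_sets[OF A])
  note [measurable] = h
  have "phase_law i (distr P borel absorption_time)"
    by (rule phase_law_phase_type) (use P in \<open>auto simp: phase_type_distribution_def hat_vector_axis\<close>)
  then have "\<mu> i = distr P borel absorption_time"
    using \<mu> phase_law_unique by blast
  then have "(\<integral>\<^sup>+r. h r \<partial>\<mu> i) = (\<integral>\<^sup>+\<omega>. h (absorption_time \<omega>) \<partial>P)"
    by (simp add: nn_integral_distr)
  also have "\<dots> \<le> (\<integral>\<^sup>+\<omega>. K + (\<Sum>j\<in>UNIV. indicator (?B j) \<omega> * h (s + (absorption_time \<omega> - s))) \<partial>P)"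
  proof (rule nn_integral_mono_AE)
    show "AE \<omega> in P. h (absorption_time \<omega>) \<le> K + (\<Sum>j\<in>UNIV. indicator (?B j) \<omega> * h (s + (absorption_time \<omega> - s)))"
      using AE_absorbed_path[OF P] AE_space
    proof eventually_elim
      case (elim \<omega>)
      note less = less_absorption_time_iff[OF markov_chain_right_constant[OF P elim(2)] elim(1)]
      have nonneg: "0 \<le> absorption_time \<omega>"
        using elim(1) unfolding absorption_time_def absorbed_path_def by (intro cInf_greatest) auto
      show ?case
      proof (cases "\<omega> s")
        case None
        then have "absorption_time \<omega> \<le> s" using less[OF s] by simp
        then show ?thesis using K[OF nonneg] by (simp add: add_increasing2)
      next
        case (Some j)
        have "(\<Sum>k\<in>UNIV. indicator (?B k) \<omega> * h (s + (absorption_time \<omega> - s))) =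
            (\<Sum>k\<in>UNIV. if k = j then h (absorption_time \<omega>) else 0)"
          using Some elim(2) by (intro sum.cong) auto
        then show ?thesis by (simp add: add_increasing)
      qed
    qed
  qed
  also have "\<dots> = K + (\<Sum>j\<in>UNIV. \<integral>\<^sup>+\<omega>. indicator (?B j) \<omega> * h (s + (absorption_time \<omega> - s)) \<partial>P)"
  proof -
    define F where "F j \<omega> = indicator (?B j) \<omega> * h (s + (absorption_time \<omega> - s))" for j \<omega>
    have F: "F j \<in> borel_measurable P" for j
      unfolding F_def[abs_def] by measurable
    have "(\<integral>\<^sup>+\<omega>. K + (\<Sum>j\<in>UNIV. F j \<omega>) \<partial>P) = (\<integral>\<^sup>+\<omega>. K \<partial>P) + (\<integral>\<^sup>+\<omega>. (\<Sum>j\<in>UNIV. F j \<omega>) \<partial>P)"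
      by (intro nn_integral_add borel_measurable_sum F) simp
    also have "(\<integral>\<^sup>+\<omega>. (\<Sum>j\<in>UNIV. F j \<omega>) \<partial>P) = (\<Sum>j\<in>UNIV. \<integral>\<^sup>+\<omega>. F j \<omega> \<partial>P)"
      by (intro nn_integral_sum F)
    also have "(\<integral>\<^sup>+\<omega>. K \<partial>P) = K"
      by (simp add: emeasure_space_1)
    finally show ?thesis by (simp only: F_def)
  qed
  also have "(\<Sum>j\<in>UNIV. \<integral>\<^sup>+\<omega>. indicator (?B j) \<omega> * h (s + (absorption_time \<omega> - s)) \<partial>P) =
      (\<Sum>j\<in>UNIV. ennreal (tr s (Some i) (Some j)) * (\<integral>\<^sup>+r. h (s + r) \<partial>\<mu> j))"
  proof (intro sum.cong refl)
    fix j
    have "(\<integral>\<^sup>+\<omega>. indicator (?B j) \<omega> * h (s + (absorption_time \<omega> - s)) \<partial>P) =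
        emeasure P (?B j) * (\<integral>\<^sup>+r. h (s + r) \<partial>\<mu> j)"
      by (rule it.nn_integral_residual[OF A \<mu>, where h="\<lambda>r. h (s + r)"]) measurable
    also have "emeasure P (?B j) = ennreal (tr s (Some i) (Some j))"
      using markov_chain_one_time[OF P s, of "Some j"]
      by (simp add: emeasure_eq_measure law_at_axis tr_def Int_absorb1)
    finally show "(\<integral>\<^sup>+\<omega>. indicator (?B j) \<omega> * h (s + (absorption_time \<omega> - s)) \<partial>P) =
        ennreal (tr s (Some i) (Some j)) * (\<integral>\<^sup>+r. h (s + r) \<partial>\<mu> j)" .
  qed
  finally show ?thesis .
qed

end

context AR_kernel
begin

definition reachable :: "'m \<Rightarrow> bool" where
  "reachable j \<longleftrightarrow> (\<exists>t\<ge>0. law_at (hat_matrix Q) (hat_vector \<alpha>) t (Some j) \<noteq> 0)"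

lemma reachable_pos:
  assumes "reachable j" "0 < t"
  shows "0 < law_at (hat_matrix Q) (hat_vector \<alpha>) t (Some j)"
proof -
  have mc: "markov_chain M (hat_matrix Q) (hat_vector \<alpha>) (J 1)" by (rule chain) simp
  show ?thesis
    using assms law_at_zero_imp_zero[OF mc assms(2), of "Some j"] law_at_nonneg[OF mc, of t "Some j"]
    by (auto simp: reachable_def less_le)
qed

lemma reachable_step:
  assumes "reachable i" "0 \<le> s" "tr s (Some i) (Some j) \<noteq> 0"
  shows "reachable j"
proof -
  have mc: "markov_chain M (hat_matrix Q) (hat_vector \<alpha>) (J 1)" by (rule chain) simp
  have "0 < law_at (hat_matrix Q) (hat_vector \<alpha>) 1 (Some i) * tr s (Some i) (Some j)"
    using reachable_pos[OF assms(1), of 1] assms(3) tr_nonneg[OF assms(2), of "Some i" "Some j"] by simp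
  also have "\<dots> \<le> law_at (hat_matrix Q) (hat_vector \<alpha>) (1 + s) (Some j)"
    using assms(2) by (intro law_at_add_ge[OF mc]) auto
  finally show ?thesis
    using assms(2) unfolding reachable_def by (intro exI[of _ "1 + s"]) auto
qed

lemma emeasure_cross:
  "emeasure M (cross c x i n) =
    (\<integral>\<^sup>+\<omega>. indicator (below c x n) \<omega> * ennreal (law_at (hat_matrix Q) (hat_vector \<alpha>) (level c x n \<omega>) (Some i)) \<partial>M)"
  unfolding cross_def by (rule independent_time.one_time_random[OF independent_time_level below_others])

text \<open>The level is positive while the process is below \<open>c\<close>, and at every positive time each reachable
  state carries mass. So whether a crossing in \<open>i\<close> is possible, even in the first step, depends
  neither on the threshold nor on the start.\<close>

lemma \<Phi>_nonzero_iff: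
  assumes c: "0 \<le> c" and x: "x < c" and \<rho>: "0 < \<rho>"
  shows "\<Phi> \<rho> i c x \<noteq> 0 \<longleftrightarrow> reachable i"
proof
  assume "\<Phi> \<rho> i c x \<noteq> 0"
  then obtain n where n: "emeasure M (cross c x i n) \<noteq> 0"
    unfolding \<Phi>_series[OF c x] by force
  show "reachable i"
  proof (rule ccontr)
    assume "\<not> reachable i"
    then have "law_at (hat_matrix Q) (hat_vector \<alpha>) (level c x n \<omega>) (Some i) = 0" for \<omega>
      by (auto simp: reachable_def level_def)
    then have "emeasure M (cross c x i n) = 0"
      unfolding emeasure_cross by simp
    then show False using n by simp
  qed
next
  assume r: "reachable i"
  show "\<Phi> \<rho> i c x \<noteq> 0"
  proof
    assume "\<Phi> \<rho> i c x = 0"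
    moreover have "emeasure M (cross c x i 0) * ennreal (\<rho> ^ Suc 0) \<le> \<Phi> \<rho> i c x"
      unfolding \<Phi>_series[OF c x]
      using sum_le_suminf[of "\<lambda>n. emeasure M (cross c x i n) * ennreal (\<rho> ^ Suc n)" "{0}"] by simp
    ultimately have "emeasure M (cross c x i 0) = 0" using \<rho> by simp
    moreover have meas: "(\<lambda>\<omega>. indicator (below c x 0) \<omega> *
        ennreal (law_at (hat_matrix Q) (hat_vector \<alpha>) (level c x 0 \<omega>) (Some i))) \<in> borel_measurable M"
    proof -
      have [measurable]: "below c x 0 \<in> sets M"
        by (rule independent_time.H_imp_M[OF independent_time_level below_others])
      have "level c x 0 \<in> borel_measurable M"
        by (rule independent_time.measurable_H_imp_M[OF independent_time_level level_others])
      then have [measurable]: "(\<lambda>\<omega>. law_at (hat_matrix Q) (hat_vector \<alpha>) (level c x 0 \<omega>) (Some i)) \<in> borel_measurable M"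
        by (rule independent_time.law_measurable[OF independent_time_level])
      show ?thesis by measurable
    qed
    ultimately have "AE \<omega> in M. indicator (below c x 0) \<omega> *
        ennreal (law_at (hat_matrix Q) (hat_vector \<alpha>) (level c x 0 \<omega>) (Some i)) = 0"
      unfolding emeasure_cross using nn_integral_0_iff_AE[OF meas] by simp
    then have "AE \<omega> in M. False"
      using AE_space
    proof eventually_elim
      case (elim \<omega>)
      then have b: "\<omega> \<in> below c x 0" using x by (simp add: below_def)
      then show ?case
        using elim(1) reachable_pos[OF r level_below(2)[OF c b]] by simp
    qed
    then show False by simp
  qed
qed

lemma \<Phi>_le_1:
  assumes "0 < \<rho>" "\<rho> < 1"
  shows "\<Phi> \<rho> i c x \<le> 1"
proof -
  have "\<Phi> \<rho> i c x \<le> (\<integral>\<^sup>+\<omega>. 1 \<partial>M)"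
    unfolding \<Phi>_def
  proof (rule nn_integral_mono)
    fix \<omega>
    have "\<rho> ^ n \<le> 1" for n using assms by (intro power_le_one) auto
    then show "(case \<tau> c x \<omega> of enat n \<Rightarrow> ennreal (\<rho> ^ n) | \<infinity> \<Rightarrow> 0) * indicator (G i c x) \<omega> \<le> 1"
      by (auto simp: indicator_def split: enat.split)
  qed
  then show ?thesis by (simp add: emeasure_space_1)
qed

section \<open>Threshold times as stopping times\<close>

lemma space_filt: "space (filt t) = space M"
  unfolding filt_def by (rule space_measure_of) auto

lemma Z_filt:
  assumes "1 \<le> k" "enat k \<le> t"
  shows "Z k \<in> borel_measurable (filt t)"
proof (rule measurableI)
  fix A :: "real set" assume A: "A \<in> sets borel"
  have "sets (filt t) = sigma_sets (space M) {Z k -` A \<inter> space M | k A. 1 \<le> k \<and> enat k \<le> t \<and> A \<in> sets borel}"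
    unfolding filt_def by (rule sets_measure_of) auto
  then show "Z k -` A \<inter> space (filt t) \<in> sets (filt t)"
    unfolding space_filt using A assms by (auto intro!: sigma_sets.Basic)
qed simp

lemma X_filt:
  assumes "enat n \<le> t"
  shows "X x n \<in> borel_measurable (filt t)"
  using assms
proof (induction n)
  case 0
  have "X x 0 = (\<lambda>\<omega>. x)" by auto
  then show ?case by simp
next
  case (Suc n)
  have n: "enat n \<le> t" using Suc.prems by (metis Suc_ile_eq order_less_imp_le)
  have "X x (Suc n) = (\<lambda>\<omega>. lam * X x n \<omega> + Z (Suc n) \<omega>)" by auto
  then show ?case
    using Suc.IH[OF n] Z_filt[OF _ Suc.prems] by simp
qed

lemma stopping_time_\<tau>: "stopping_time filt (\<tau> c x)"
proof (rule stopping_timeI)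
  fix t :: enat
  show "Measurable.pred (filt t) (\<lambda>\<omega>. \<tau> c x \<omega> \<le> t)"
  proof (cases t)
    case (enat m)
    have "(\<tau> c x \<omega> \<le> t) \<longleftrightarrow> (\<exists>n\<in>{..m}. c \<le> X x n \<omega>)" for \<omega>
    proof
      assume le: "\<tau> c x \<omega> \<le> t"
      then obtain n where n: "\<tau> c x \<omega> = enat n" "n \<le> m"
        using enat by (cases "\<tau> c x \<omega>") auto
      then show "\<exists>n\<in>{..m}. c \<le> X x n \<omega>" by (auto simp: \<tau>_eq_iff)
    next
      assume "\<exists>n\<in>{..m}. c \<le> X x n \<omega>"
      then obtain n where "n \<le> m" "c \<le> X x n \<omega>" by blast
      then have "\<tau> c x \<omega> \<le> enat n" unfolding \<tau>_def by (intro INF_lower) simp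
      then show "\<tau> c x \<omega> \<le> t" using enat \<open>n \<le> m\<close> by (meson enat_ord_simps(1) order_trans)
    qed
    moreover have [measurable]: "X x n \<in> borel_measurable (filt t)" if "n \<in> {..m}" for n
      using that enat by (intro X_filt) simp
    ultimately show ?thesis by simp
  qed simp
qed

lemma expected_payoff_le_v: "stopping_time filt \<sigma> \<Longrightarrow> expected_payoff \<rho> g x \<sigma> \<le> v \<rho> g x"
  unfolding v_def by (intro SUP_upper) simp

lemma payoff_now_le_v: "ennreal (g x) \<le> v \<rho> g x"
proof -
  have "expected_payoff \<rho> g x (\<lambda>_. enat 0) = ennreal (g x)"
    by (simp add: expected_payoff_def emeasure_space_1)
  then show ?thesis
    using expected_payoff_le_v[OF stopping_time_const, of \<rho> g x "enat 0"] by simp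
qed

text \<open>The threshold \<open>b + 1\<close> gives an admissible rule for the start \<open>b\<close>, where the value is finite, and
  each reachable state is among its crossing states; so the expectations from level \<open>b + 1\<close> on are
  finite. The chain started in \<open>i\<close> moves to reachable states only, and \<open>g\<close> is bounded on
  \<open>{b..b + 1}\<close>.\<close>

lemma nn_integral_reachable_finite:
  assumes b: "0 \<le> b" and \<rho>: "0 < \<rho>" and g: "continuous_on UNIV g"
    and \<mu>: "\<And>i. phase_law i (\<mu> i)"
    and vb: "v \<rho> g b < \<top>" and i: "reachable i"
  shows "(\<integral>\<^sup>+r. ennreal (g (b + r)) \<partial>\<mu> i) < \<top>"
proof -
  note gm [measurable] = borel_measurable_continuous_onI[OF g]
  have fin: "(\<integral>\<^sup>+r. ennreal (g (b + 1 + r)) \<partial>\<mu> j) < \<top>" if j: "reachable j" for j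
  proof (rule ccontr)
    assume "\<not> ?thesis"
    then have inf: "(\<integral>\<^sup>+r. ennreal (g (b + 1 + r)) \<partial>\<mu> j) = \<top>"
      by (simp add: not_less top_unique)
    have "\<Phi> \<rho> j (b + 1) b \<noteq> 0"
      using \<Phi>_nonzero_iff[of "b + 1" b \<rho> j] b \<rho> j by simp
    then have "\<top> = \<Phi> \<rho> j (b + 1) b * (\<integral>\<^sup>+r. ennreal (g (b + 1 + r)) \<partial>\<mu> j)"
      by (simp add: inf ennreal_mult_top)
    also have "\<dots> \<le> (\<Sum>j\<in>UNIV. \<Phi> \<rho> j (b + 1) b * (\<integral>\<^sup>+r. ennreal (g (b + 1 + r)) \<partial>\<mu> j))"
      by (intro member_le_sum) auto
    also have "\<dots> = expected_payoff \<rho> g b (\<tau> (b + 1) b)"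
      using b \<rho> by (intro expected_payoff_threshold[symmetric] \<mu>) auto
    also have "\<dots> \<le> v \<rho> g b" by (rule expected_payoff_le_v[OF stopping_time_\<tau>])
    finally show False using vb by simp
  qed
  have "compact (g ` {b..b + 1})"
    using g by (intro compact_continuous_image) (auto intro: continuous_on_subset)
  then have "bounded (g ` {b..b + 1})"
    by (rule compact_imp_bounded)
  then obtain K where "\<forall>z\<in>g ` {b..b + 1}. \<bar>z\<bar> \<le> K"
    unfolding bounded_real by auto
  then have K: "\<bar>g y\<bar> \<le> K" if "y \<in> {b..b + 1}" for y
    using that by simp
  have "(\<integral>\<^sup>+r. ennreal (g (b + r)) \<partial>\<mu> i) \<le> ennreal K +
      (\<Sum>j\<in>UNIV. ennreal (tr 1 (Some i) (Some j)) * (\<integral>\<^sup>+r. ennreal (g (b + (1 + r))) \<partial>\<mu> j))"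
  proof (rule nn_integral_phase_law_shift[where h="\<lambda>r. ennreal (g (b + r))", OF _ \<mu>])
    show "ennreal (g (b + r)) \<le> ennreal K" if "0 \<le> r" "r \<le> 1" for r
      using K[of "b + r"] that by (intro ennreal_leI) auto
  qed auto
  also have "\<dots> < \<top>"
  proof -
    have "ennreal (tr 1 (Some i) (Some j)) * (\<integral>\<^sup>+r. ennreal (g (b + (1 + r))) \<partial>\<mu> j) < \<top>" for j
    proof (cases "tr 1 (Some i) (Some j) = 0")
      case False
      then have "reachable j" using reachable_step[OF i, of 1 j] by simp
      then show ?thesis using fin[of j] by (simp add: ennreal_mult_less_top add.assoc)
    qed simp
    then show ?thesis by (simp add: ennreal_add_less_top)
  qed
  finally show ?thesis .
qed

end

theorem proposition6p1:
  fixes M :: "'a measure" and Q :: "real^'m^'m" and \<alpha> :: "real^'m" and lam :: real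
    and J :: "nat \<Rightarrow> real \<Rightarrow> 'a \<Rightarrow> 'm option" and T :: "nat \<Rightarrow> 'a \<Rightarrow> real"
    and \<rho> :: real and g :: "real \<Rightarrow> real" and b :: real
    and N :: "'m \<Rightarrow> 'b measure" and R :: "'m \<Rightarrow> 'b \<Rightarrow> real"
  assumes process: "phase_type_AR M Q \<alpha> lam J T"
    and rho: "0 < \<rho>" "\<rho> < 1"
    and g_continuous: "continuous_on UNIV g"
    and g_nonneg: "\<And>x. 0 \<le> g x"
    and b_nonneg: "0 \<le> b"
    and stopping_set: "phase_type_AR.optimal_stopping_set M lam J T \<rho> g = {b..}"
    and optimal: "\<And>x. phase_type_AR.expected_payoff M lam J T \<rho> g x (phase_type_AR.\<tau> lam J T b x)
                    = phase_type_AR.v M lam J T \<rho> g x"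
    and Phi_limits: "\<And>i. \<exists>L.
          ((\<lambda>\<epsilon>. phase_type_AR.\<Phi> M lam J T \<rho> i b (b - \<epsilon>)) \<longlongrightarrow> L) (at_right 0) \<and>
          ((\<lambda>\<epsilon>. phase_type_AR.\<Phi> M lam J T \<rho> i (b + \<epsilon>) b) \<longlongrightarrow> L) (at_right 0)"
    and R_space: "\<And>i. prob_space (N i)"
    and R_measurable: "\<And>i. R i \<in> borel_measurable (N i)"
    and R_phase_type: "\<And>i. phase_type_distribution Q (axis i 1) (distr (N i) borel (R i))"
    and g_R_limit: "\<And>i. ((\<lambda>\<epsilon>. \<integral>\<^sup>+\<omega>. ennreal (g (R i \<omega> + \<epsilon> + b)) \<partial>N i)
                          \<longlongrightarrow> (\<integral>\<^sup>+\<omega>. ennreal (g (R i \<omega> + b)) \<partial>N i)) (at 0)"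
  shows "((\<lambda>x. phase_type_AR.v M lam J T \<rho> g x) \<longlongrightarrow> ennreal (g b)) (at_left b)"
proof -
  interpret phase_type_AR M Q \<alpha> lam J T by (rule process)
  interpret AR_kernel M Q \<alpha> lam J T
  proof
    show "phase_type_matrix Q" by (rule phase_type_matrix)
    show "\<exists>P::(real \<Rightarrow> 'm option) measure.
        markov_chain P (hat_matrix Q) (axis (Some i) 1) (\<lambda>t \<omega>. \<omega> t)" for i
      using R_phase_type[of i] unfolding phase_type_distribution_def hat_vector_axis by blast
  qed
  have gm [measurable]: "g \<in> borel_measurable borel"
    by (rule borel_measurable_continuous_onI[OF g_continuous])
  define E where "E i c = (\<integral>\<^sup>+r. ennreal (g (c + r)) \<partial>distr (N i) borel (R i))" for i c
  have phase: "phase_law i (distr (N i) borel (R i))" for i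
    by (rule phase_law_phase_type[OF R_phase_type])
  have E: "E i c = (\<integral>\<^sup>+\<omega>. ennreal (g (c + R i \<omega>)) \<partial>N i)" for i c
    unfolding E_def using R_measurable by (subst nn_integral_distr) auto
  have payoff: "expected_payoff \<rho> g x (\<tau> c x) = (\<Sum>i\<in>UNIV. \<Phi> \<rho> i c x * E i c)" if "0 \<le> c" "x < c" for c x
    unfolding E_def using that rho by (intro expected_payoff_threshold phase) auto
  have vb: "v \<rho> g b = ennreal (g b)"
    using stopping_set unfolding optimal_stopping_set_def by auto
  have E_finite: "E i b < \<top>" if "reachable i" for i
    unfolding E_def
    by (rule nn_integral_reachable_finite[OF b_nonneg rho(1) g_continuous phase _ that]) (simp add: vb)
  have E_lim: "((\<lambda>\<epsilon>. E i (b + \<epsilon>)) \<longlongrightarrow> E i b) (at_right 0)" for i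
    using g_R_limit[of i] unfolding E filterlim_at_split by (simp add: ac_simps)
  obtain L where L: "\<And>i. ((\<lambda>\<epsilon>. \<Phi> \<rho> i b (b - \<epsilon>)) \<longlongrightarrow> L i) (at_right 0)"
      "\<And>i. ((\<lambda>\<epsilon>. \<Phi> \<rho> i (b + \<epsilon>) b) \<longlongrightarrow> L i) (at_right 0)"
    using Phi_limits by metis
  have L_le: "L i \<le> 1" for i
    by (rule tendsto_upperbound[OF L(1)]) (auto simp: \<Phi>_le_1[OF rho])
  then have L_top: "L i \<noteq> \<top>" for i
    by (metis ennreal_one_neq_top top.extremum_unique)
  have pos: "\<forall>\<^sub>F \<epsilon> in at_right 0. 0 < (\<epsilon>::real)"
    by (simp add: eventually_at_right_less)
  define lim_payoff where "lim_payoff = (\<Sum>i\<in>UNIV. if reachable i then L i * E i b else 0)"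
  \<comment> \<open>Unreachable states are treated apart, because for them the expectation of \<open>g\<close> may be infinite.\<close>
  have from_left: "((\<lambda>\<epsilon>. \<Sum>i\<in>UNIV. \<Phi> \<rho> i b (b - \<epsilon>) * E i b) \<longlongrightarrow> lim_payoff) (at_right 0)"
    unfolding lim_payoff_def
  proof (intro tendsto_sum)
    fix i
    show "((\<lambda>\<epsilon>. \<Phi> \<rho> i b (b - \<epsilon>) * E i b) \<longlongrightarrow> (if reachable i then L i * E i b else 0)) (at_right 0)"
    proof (cases "reachable i")
      case True
      then show ?thesis
        using E_finite[OF True] L_top[of i] by (auto intro!: tendsto_mult_ennreal L)
    next
      case False
      have "\<forall>\<^sub>F \<epsilon> in at_right 0. \<Phi> \<rho> i b (b - \<epsilon>) * E i b = 0"
        using pos by eventually_elim (use False \<Phi>_nonzero_iff[OF b_nonneg _ rho(1), of _ i] in auto)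
      then show ?thesis using False by (auto intro: tendsto_eventually)
    qed
  qed
  have from_right: "((\<lambda>\<epsilon>. \<Sum>i\<in>UNIV. \<Phi> \<rho> i (b + \<epsilon>) b * E i (b + \<epsilon>)) \<longlongrightarrow> lim_payoff) (at_right 0)"
    unfolding lim_payoff_def
  proof (intro tendsto_sum)
    fix i
    show "((\<lambda>\<epsilon>. \<Phi> \<rho> i (b + \<epsilon>) b * E i (b + \<epsilon>)) \<longlongrightarrow> (if reachable i then L i * E i b else 0)) (at_right 0)"
    proof (cases "reachable i")
      case True
      then show ?thesis
        using E_finite[OF True] L_top[of i] by (auto intro!: tendsto_mult_ennreal L E_lim)
    next
      case False
      have "\<forall>\<^sub>F \<epsilon> in at_right 0. \<Phi> \<rho> i (b + \<epsilon>) b * E i (b + \<epsilon>) = 0"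
        using pos
      proof eventually_elim
        case (elim \<epsilon>)
        then show ?case
          using False \<Phi>_nonzero_iff[of "b + \<epsilon>" b \<rho> i] b_nonneg rho by auto
      qed
      then show ?thesis using False by (auto intro: tendsto_eventually)
    qed
  qed
  have "\<forall>\<^sub>F \<epsilon> in at_right 0. (\<Sum>i\<in>UNIV. \<Phi> \<rho> i (b + \<epsilon>) b * E i (b + \<epsilon>)) \<le> ennreal (g b)"
    using pos
  proof eventually_elim
    case (elim \<epsilon>)
    have "(\<Sum>i\<in>UNIV. \<Phi> \<rho> i (b + \<epsilon>) b * E i (b + \<epsilon>)) = expected_payoff \<rho> g b (\<tau> (b + \<epsilon>) b)"
      using b_nonneg elim by (intro payoff[symmetric]) auto
    also have "\<dots> \<le> v \<rho> g b" by (rule expected_payoff_le_v[OF stopping_time_\<tau>])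
    finally show ?case by (simp add: vb)
  qed
  then have upper: "lim_payoff \<le> ennreal (g b)"
    by (intro tendsto_upperbound[OF from_right]) auto
  have v_lim: "((\<lambda>x. v \<rho> g x) \<longlongrightarrow> lim_payoff) (at_left b)"
  proof -
    have "filterlim (\<lambda>x. b - x) (at_right 0) (at_left b)"
      unfolding filterlim_at
      by (auto intro!: tendsto_eq_intros simp: eventually_at_filter)
    from filterlim_compose[OF from_left this]
    have "((\<lambda>x. \<Sum>i\<in>UNIV. \<Phi> \<rho> i b x * E i b) \<longlongrightarrow> lim_payoff) (at_left b)" by simp
    moreover have "\<forall>\<^sub>F x in at_left b. (\<Sum>i\<in>UNIV. \<Phi> \<rho> i b x * E i b) = v \<rho> g x"
      unfolding eventually_at_filter
      by (intro always_eventually allI impI) (simp add: payoff[OF b_nonneg, symmetric] optimal)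
    ultimately show ?thesis by (rule Lim_transform_eventually)
  qed
  have g_lim: "((\<lambda>x. ennreal (g x)) \<longlongrightarrow> ennreal (g b)) (at_left b)"
    using g_continuous
    by (intro tendsto_ennrealI) (auto simp: continuous_on_def intro: tendsto_within_subset)
  have "ennreal (g b) \<le> lim_payoff"
    by (rule tendsto_le[OF _ v_lim g_lim]) (auto simp: payoff_now_le_v)
  with upper have "lim_payoff = ennreal (g b)" by (rule antisym)
  with v_lim show ?thesis by simp
qed

end
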